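(* Let $n\geq3$ and let $\rho_{A_1A_2A_3}$ be a state on $H_{A_1}\otimes H_{A_2}\otimes H_{A_3}$ with $\dim H_{A_1}=\dim H_{A_2}=2$, $\dim H_{A_3}=2^{n-2}$. Let $k\geq 1$, $0<q\leq 1$, $\beta\leq 0$, $s\geq 2$. (1) If $C^s(\rho_{A_1A_3})\geq k\,C^s(\rho_{A_1A_2})$, then $$C^\beta(\rho_{A_1|A_2A_3})\leq q^{\beta/s}C^\beta(\rho_{A_1A_2})+\frac{(1+k)^{\beta/s}-q^{\beta/s}}{k^{\beta/s}}C^\beta(\rho_{A_1A_3}).$$ (2) If $C^s(\rho_{A_1A_2})\geq k\,C^s(\rho_{A_1A_3})$, then $$C^\beta(\rho_{A_1|A_2A_3})\leq q^{\beta/s}C^\beta(\rho_{A_1A_3})+\frac{(1+k)^{\beta/s}-q^{\beta/s}}{k^{\beta/s}}C^\beta(\rho_{A_1A_2}).$$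
   Context: For a bipartite pure state $|\varphi\rangle_{XY}$, the concurrence is $C(|\varphi\rangle)=\sqrt{2[1-\mathrm{tr}(\rho_X^2)]}$ with $\rho_X=\mathrm{tr}_Y|\varphi\rangle\langle\varphi|$; for mixed $\rho_{XY}$, $C(\rho_{XY})=\min\sum_ip_iC(|\varphi_i\rangle)$ over all pure-state ensembles $\{p_i,|\varphi_i\rangle\}$ of $\rho_{XY}$. $\rho_{A_1A_2},\rho_{A_1A_3}$ are reduced states, and $\rho_{A_1|A_2A_3}$ is $\rho_{A_1A_2A_3}$ viewed as a bipartite state for the cut $A_1$ versus $A_2A_3$. $C^\beta$ is the $\beta$-th power of concurrence.
   Formalization: The formal statement additionally assumes C(ρ_{A1A2})>0 and C(ρ_{A1A3})>0, because for β<0 the powers C^β are undefined when a concurrence vanishes (e.g. for product states). *)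

theory Defs
  imports Complex_Main
begin

text \<open>Finite-dimensional operators on C^d are represented as functions
  nat => nat => complex, only the entries with indices < d being relevant;
  vectors as functions nat => complex.  A bipartite system X (dim dX) times
  Y (dim dY) uses the standard tensor index  x * dY + y.\<close>

definition density_op :: "nat \<Rightarrow> (nat \<Rightarrow> nat \<Rightarrow> complex) \<Rightarrow> bool" where
  "density_op d \<rho> \<longleftrightarrow>
     (\<forall>v :: nat \<Rightarrow> complex.
        Im (\<Sum>i<d. \<Sum>j<d. cnj (v i) * \<rho> i j * v j) = 0 \<and>
        Re (\<Sum>i<d. \<Sum>j<d. cnj (v i) * \<rho> i j * v j) \<ge> 0) \<and>
     (\<Sum>i<d. \<rho> i i) = 1"

definition unit_vec :: "nat \<Rightarrow> (nat \<Rightarrow> complex) \<Rightarrow> bool" where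
  "unit_vec d \<psi> \<longleftrightarrow> (\<Sum>i<d. (cmod (\<psi> i))\<^sup>2) = 1"

definition proj :: "(nat \<Rightarrow> complex) \<Rightarrow> nat \<Rightarrow> nat \<Rightarrow> complex" where
  "proj \<psi> = (\<lambda>i j. \<psi> i * cnj (\<psi> j))"

definition ptrace2 :: "nat \<Rightarrow> nat \<Rightarrow> (nat \<Rightarrow> nat \<Rightarrow> complex) \<Rightarrow> nat \<Rightarrow> nat \<Rightarrow> complex" where
  "ptrace2 dX dY \<rho> = (\<lambda>a b. \<Sum>y<dY. \<rho> (a * dY + y) (b * dY + y))"

definition ptrace_mid :: "nat \<Rightarrow> nat \<Rightarrow> nat \<Rightarrow> (nat \<Rightarrow> nat \<Rightarrow> complex) \<Rightarrow> nat \<Rightarrow> nat \<Rightarrow> complex" where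
  "ptrace_mid d1 d2 d3 \<rho> = (\<lambda>a b.
     \<Sum>y<d2. \<rho> ((a div d3 * d2 + y) * d3 + a mod d3) ((b div d3 * d2 + y) * d3 + b mod d3))"

definition mtrace :: "nat \<Rightarrow> (nat \<Rightarrow> nat \<Rightarrow> complex) \<Rightarrow> complex" where
  "mtrace d M = (\<Sum>i<d. M i i)"

definition msquare :: "nat \<Rightarrow> (nat \<Rightarrow> nat \<Rightarrow> complex) \<Rightarrow> nat \<Rightarrow> nat \<Rightarrow> complex" where
  "msquare d M = (\<lambda>i j. \<Sum>k<d. M i k * M k j)"

definition conc_pure :: "nat \<Rightarrow> nat \<Rightarrow> (nat \<Rightarrow> complex) \<Rightarrow> real" where
  "conc_pure dX dY \<psi> =
     sqrt (2 * (1 - Re (mtrace dX (msquare dX (ptrace2 dX dY (proj \<psi>))))))"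

definition conc :: "nat \<Rightarrow> nat \<Rightarrow> (nat \<Rightarrow> nat \<Rightarrow> complex) \<Rightarrow> real" where
  "conc dX dY \<rho> = Inf {(\<Sum>i<m. p i * conc_pure dX dY (\<psi> i)) | (m::nat) p \<psi>.
       (\<forall>i<m. p i \<ge> 0 \<and> unit_vec (dX * dY) (\<psi> i)) \<and> (\<Sum>i<m. p i) = 1 \<and>
       (\<forall>a<dX * dY. \<forall>b<dX * dY. \<rho> a b = (\<Sum>i<m. complex_of_real (p i) * proj (\<psi> i) a b))}"

end

theory Submission
  imports Defs "HOL-Analysis.Analysis"
begin

text \<open>
  The inequality follows from the monogamy relation
  \<open>C\<^sup>2(A|BC) \<ge> C\<^sup>2(AB) + C\<^sup>2(AC)\<close> for a qubit pair \<open>AB\<close> and an arbitrary \<open>C\<close>, together with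
  \<open>a\<^sup>s + b\<^sup>s \<le> (a\<^sup>2 + b\<^sup>2)\<^bsup>s/2\<^esup>\<close> and the monotonicity of negative powers.  By Minkowski's inequality, monogamy
  for mixed states reduces to producing, for a single vector, ensembles of the two reduced states
  whose average concurrences satisfy it.

  Write the vector as \<open>2 \<times> 2\<close> matrices \<open>X\<^sub>c\<close> indexed by a basis of \<open>C\<close> and put
  \<open>L(P) = \<Sum>\<^sub>c X\<^sub>c P X\<^sub>c\<^sup>*\<close>, so that \<open>C\<^sup>2(A|BC) = 4 det L(1)\<close>.  Measuring \<open>B\<close> in an orthonormal basis \<open>v, w\<close>
  gives an ensemble for \<open>AC\<close> whose squared average is at most \<open>4 det L(1) + 4 det L(n)\<close>, where
  \<open>n = vv\<^sup>* - ww\<^sup>*\<close>.  It remains to find one traceless Hermitian \<open>n\<close> with \<open>det n = -1\<close> and an ensemble \<open>Y\<close> for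
  \<open>AB\<close> with \<open>(\<Sum> |det Y|)\<^sup>2 \<le> - det L(n)\<close>.  Local filters of determinant one change neither side; minimising
  \<open>det L(P) / det P\<close> brings \<open>L\<close> into a unital and trace-preserving form, in which the \<open>AB\<close> state is
  real in Wootters' magic basis, and the ensemble is read off from the spectral decomposition of a
  real \<open>4 \<times> 4\<close> matrix.  If there is no minimiser, then \<open>L(vv\<^sup>*)\<close> is singular for some \<open>v\<close>, the \<open>X\<^sub>c v\<close> are
  collinear, and the \<open>X\<^sub>c\<close> themselves are a good ensemble by Cauchy--Schwarz.
\<close>

section \<open>Real quadratic forms\<close>

text \<open>For small t of sign opposite to a, the linear term beats the quadratic one. This is the
  first-order condition at an extremum, needed for a top eigenvector and for an optimal
  filter.\<close>

lemma linear_coeff_zero: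
  fixes a b e :: real
  assumes "e > 0" and "\<And>t. \<bar>t\<bar> < e \<Longrightarrow> a * t + b * t\<^sup>2 \<ge> 0"
  shows "a = 0"
proof (rule ccontr)
  assume a: "a \<noteq> 0"
  define t where "t = min (e/2) (\<bar>a\<bar> / (2 * (\<bar>b\<bar> + 1)))"
  have t: "0 < t" "t < e" "t \<le> \<bar>a\<bar> / (2 * (\<bar>b\<bar> + 1))" using a assms(1) by (auto simp: t_def)
  have "t * (2 * (\<bar>b\<bar> + 1)) \<le> \<bar>a\<bar>" using t(3) by (simp add: pos_le_divide_eq)
  moreover have "b * t \<le> \<bar>b\<bar> * t" using t(1) by (simp add: mult_right_mono)
  moreover have "t * (2 * (\<bar>b\<bar> + 1)) = 2 * (\<bar>b\<bar> * t) + 2 * t" "\<bar>b\<bar> * t \<ge> 0"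
    using t(1) by (simp_all add: algebra_simps)
  ultimately have bt: "b * t < \<bar>a\<bar>" using t(1) by linarith
  have "a * (- sgn a * t) + b * (- sgn a * t)\<^sup>2 \<ge> 0"
    by (rule assms(2)) (use t a in \<open>auto simp: abs_mult abs_sgn_eq\<close>)
  moreover have "a * (- sgn a * t) = - \<bar>a\<bar> * t" by (simp add: abs_sgn)
  moreover have "(- sgn a * t)\<^sup>2 = t * t" using a by (simp add: power2_eq_square sgn_if)
  ultimately have "- \<bar>a\<bar> * t + b * (t * t) \<ge> 0" by metis
  hence "t * (b * t - \<bar>a\<bar>) \<ge> 0" by (simp add: algebra_simps)
  thus False using t(1) bt by (simp add: zero_le_mult_iff)
qed

section \<open>Positive forms and their spectral decomposition\<close>

text \<open>The positive semidefinite form with matrix the sum of v v^T, kept as a list of vectors: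
  a spectral decomposition is then another list, of orthogonal vectors, for the same form.\<close>

definition qform :: "('a::real_inner) list \<Rightarrow> 'a \<Rightarrow> 'a \<Rightarrow> real" where
  "qform vs x y = (\<Sum>v\<leftarrow>vs. (v \<bullet> x) * (v \<bullet> y))"

lemma qform_simps [simp]:
  "qform [] x y = 0" "qform (v # vs) x y = (v \<bullet> x) * (v \<bullet> y) + qform vs x y"
  "qform (us @ vs) x y = qform us x y + qform vs x y"
  by (simp_all add: qform_def)

lemma qform_add: "qform vs (x + x') y = qform vs x y + qform vs x' y"
  "qform vs x (y + y') = qform vs x y + qform vs x y'"
  by (induction vs) (simp_all add: algebra_simps)

lemma qform_scale: "qform vs (c *\<^sub>R x) y = c * qform vs x y" "qform vs x (c *\<^sub>R y) = c * qform vs x y"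
  by (induction vs) (simp_all add: algebra_simps)

lemma qform_sym: "qform vs x y = qform vs y x"
  by (induction vs) (simp_all add: algebra_simps)

lemma qform_nonneg: "qform vs x x \<ge> 0"
  by (induction vs) simp_all

lemma continuous_on_qform: "continuous_on S (\<lambda>x. qform vs x x)"
  by (induction vs) (auto intro!: continuous_intros)

lemma qform_zero: "qform vs x x = 0 \<Longrightarrow> v \<in> set vs \<Longrightarrow> v \<bullet> x = 0"
proof (induction vs)
  case (Cons a vs)
  thus ?case using qform_nonneg[of vs x] zero_le_square[of "a \<bullet> x"]
    by (auto simp: add_nonneg_eq_0_iff)
qed simp

lemma qform_orth: "(\<And>v. v \<in> set vs \<Longrightarrow> v \<bullet> x = 0) \<Longrightarrow> qform vs x y = 0"
  by (induction vs) auto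

text \<open>One step of the spectral decomposition of a positive form: split off a top eigenvector,
  scaled by the square root of its eigenvalue (so that the zero form needs no special case).\<close>

lemma qform_peel:
  fixes vs :: "('a::euclidean_space) list"
  shows "\<exists>u us. (\<forall>x y. qform vs x y = (u \<bullet> x) * (u \<bullet> y) + qform us x y) \<and>
    (\<forall>v\<in>set us. v \<bullet> u = 0) \<and> (\<forall>x. qform vs x x \<le> (u \<bullet> u) * (x \<bullet> x)) \<and>
    (\<forall>w. (\<forall>v\<in>set vs. v \<bullet> w = 0) \<longrightarrow> u \<bullet> w = 0 \<and> (\<forall>v\<in>set us. v \<bullet> w = 0)) \<and>
    (\<exists>e. norm e = 1 \<and> qform vs e e = u \<bullet> u)"
proof -
  have "compact (sphere (0::'a) 1)" "sphere (0::'a) 1 \<noteq> {}" by auto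
  from continuous_attains_sup[OF this continuous_on_qform[of _ vs]]
  obtain e where e: "norm e = 1" and mx: "\<And>x. norm x = 1 \<Longrightarrow> qform vs x x \<le> qform vs e e"
    by (auto simp: dist_norm)
  define p where "p = qform vs e e"
  have p0: "p \<ge> 0" by (simp add: p_def qform_nonneg)
  have ee: "e \<bullet> e = 1" using e by (simp add: norm_eq_1)
  have bound: "qform vs x x \<le> p * (x \<bullet> x)" for x
  proof (cases "x = 0")
    case True thus ?thesis by (simp add: qform_def)
  next
    case False
    have "qform vs ((1/norm x) *\<^sub>R x) ((1/norm x) *\<^sub>R x) \<le> p"
      unfolding p_def by (rule mx) (use False in simp)
    hence "qform vs x x \<le> p * (norm x)\<^sup>2"
      using False by (simp add: qform_scale field_simps power2_eq_square)
    thus ?thesis by (simp add: power2_norm_eq_inner)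
  qed
  have stat: "qform vs e y = 0" if "e \<bullet> y = 0" for y
  proof -
    \<comment> \<open>Perturbing the maximiser \<open>e\<close> by t y respects the Rayleigh bound
      for every t, so the term linear in t vanishes.\<close>
    have "0 \<le> - 2 * qform vs e y * t + (p * (y \<bullet> y) - qform vs y y) * t\<^sup>2" for t
    proof -
      have "qform vs (e + t *\<^sub>R y) (e + t *\<^sub>R y) \<le> p * ((e + t *\<^sub>R y) \<bullet> (e + t *\<^sub>R y))"
        by (rule bound)
      thus ?thesis using that
        by (simp add: qform_add qform_scale inner_add ee inner_commute[of y e]
            qform_sym[of vs y e] p_def[symmetric] algebra_simps power2_eq_square)
    qed
    from linear_coeff_zero[OF zero_less_one this] show ?thesis by simp
  qed
  define u where "u = sqrt p *\<^sub>R e"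
  \<comment> \<open>Each vector is projected onto the orthogonal complement of \<open>e\<close>; the
    mixed terms are zero by \<open>stat\<close>.\<close>
  define us where "us = map (\<lambda>v. v - (v \<bullet> e) *\<^sub>R e) vs"
  have us: "qform us x y = qform vs (x - (e \<bullet> x) *\<^sub>R e) (y - (e \<bullet> y) *\<^sub>R e)" for x y
    unfolding us_def by (induction vs) (simp_all add: algebra_simps inner_diff)
  have uu: "u \<bullet> u = p" using p0 by (simp add: u_def ee)
  show ?thesis
  proof (rule exI[of _ u], rule exI[of _ us], intro conjI allI ballI impI)
    fix x y
    have o: "e \<bullet> (x - (e \<bullet> x) *\<^sub>R e) = 0" for x by (simp add: inner_diff ee)
    have "qform vs x y = qform us x y + (e \<bullet> x) * (e \<bullet> y) * p"
    proof -
      define x' y' where "x' = x - (e \<bullet> x) *\<^sub>R e" and "y' = y - (e \<bullet> y) *\<^sub>R e"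
      have "qform vs e x' = 0" "qform vs e y' = 0" using stat o by (simp_all add: x'_def y'_def)
      moreover have "qform vs x y = qform vs (x' + (e \<bullet> x) *\<^sub>R e) (y' + (e \<bullet> y) *\<^sub>R e)"
        by (simp add: x'_def y'_def)
      moreover have "qform us x y = qform vs x' y'" by (simp add: us x'_def y'_def)
      ultimately show ?thesis by (simp add: qform_add qform_scale qform_sym[of vs x' e] p_def)
    qed
    thus "qform vs x y = (u \<bullet> x) * (u \<bullet> y) + qform us x y" using p0 by (simp add: u_def)
  next
    fix v assume "v \<in> set us"
    thus "v \<bullet> u = 0" by (auto simp: us_def u_def inner_diff ee)
  next
    fix x show "qform vs x x \<le> (u \<bullet> u) * (x \<bullet> x)" using bound by (simp add: uu)
  next
    \<comment> \<open>This clause lets later peels inherit orthogonality to the vectors already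
      split off.\<close>
    fix w assume w': "\<forall>v\<in>set vs. v \<bullet> w = 0"
    hence w: "\<And>v. v \<in> set vs \<Longrightarrow> v \<bullet> w = 0" by blast
    have "qform vs e (w - (e \<bullet> w) *\<^sub>R e) = 0" by (rule stat) (simp add: inner_diff ee)
    moreover have "w - (e \<bullet> w) *\<^sub>R e = w + (- (e \<bullet> w)) *\<^sub>R e" by simp
    moreover have "qform vs e w = 0" using qform_orth[OF w] by (simp add: qform_sym)
    ultimately have "(e \<bullet> w) * p = 0" unfolding p_def by (simp only: qform_add qform_scale)
    hence 1: "p = 0 \<or> e \<bullet> w = 0" by auto
    thus "u \<bullet> w = 0" by (auto simp: u_def)
    show "v \<bullet> w = 0" if vu: "v \<in> set us" for v
    proof -
      obtain v' where v': "v' \<in> set vs" "v = v' - (v' \<bullet> e) *\<^sub>R e" using vu by (auto simp: us_def)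
      have "p = 0 \<Longrightarrow> v' \<bullet> e = 0" using qform_zero[of vs e v'] v' by (simp add: p_def)
      thus ?thesis using 1 w[OF v'(1)] v'(2) by (auto simp: inner_diff)
    qed
  next
    show "\<exists>e. norm e = 1 \<and> qform vs e e = u \<bullet> u" using e uu p_def by auto
  qed
qed

text \<open>Four peels suffice: since the eigenvalues decrease, a nonzero vector left over would
  force all four split-off vectors to be nonzero, giving five nonzero orthogonal vectors in a space
  of dimension four.\<close>

lemma qform_spectral4:
  fixes vs :: "(real^4) list"
  obtains a b c d where "\<And>x y. qform vs x y = qform [a, b, c, d] x y"
    and "a \<bullet> b = 0" "a \<bullet> c = 0" "a \<bullet> d = 0" "b \<bullet> c = 0" "b \<bullet> d = 0" "c \<bullet> d = 0"
    and "b \<bullet> b \<le> a \<bullet> a" "c \<bullet> c \<le> b \<bullet> b" "d \<bullet> d \<le> c \<bullet> c"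
    and "\<exists>e. norm e = 1 \<and> qform vs e e = a \<bullet> a"
proof -
  obtain a as where A: "\<forall>x y. qform vs x y = (a \<bullet> x) * (a \<bullet> y) + qform as x y"
    "\<forall>v\<in>set as. v \<bullet> a = 0" "\<forall>x. qform vs x x \<le> (a \<bullet> a) * (x \<bullet> x)"
    "\<forall>w. (\<forall>v\<in>set vs. v \<bullet> w = 0) \<longrightarrow> a \<bullet> w = 0 \<and> (\<forall>v\<in>set as. v \<bullet> w = 0)"
    "\<exists>e. norm e = 1 \<and> qform vs e e = a \<bullet> a" using qform_peel[of vs] by blast
  obtain b bs where B: "\<forall>x y. qform as x y = (b \<bullet> x) * (b \<bullet> y) + qform bs x y"
    "\<forall>v\<in>set bs. v \<bullet> b = 0" "\<forall>x. qform as x x \<le> (b \<bullet> b) * (x \<bullet> x)"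
    "\<forall>w. (\<forall>v\<in>set as. v \<bullet> w = 0) \<longrightarrow> b \<bullet> w = 0 \<and> (\<forall>v\<in>set bs. v \<bullet> w = 0)"
    "\<exists>e. norm e = 1 \<and> qform as e e = b \<bullet> b" using qform_peel[of as] by blast
  obtain c cs where C: "\<forall>x y. qform bs x y = (c \<bullet> x) * (c \<bullet> y) + qform cs x y"
    "\<forall>v\<in>set cs. v \<bullet> c = 0" "\<forall>x. qform bs x x \<le> (c \<bullet> c) * (x \<bullet> x)"
    "\<forall>w. (\<forall>v\<in>set bs. v \<bullet> w = 0) \<longrightarrow> c \<bullet> w = 0 \<and> (\<forall>v\<in>set cs. v \<bullet> w = 0)"
    "\<exists>e. norm e = 1 \<and> qform bs e e = c \<bullet> c" using qform_peel[of bs] by blast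
  obtain d ds where D: "\<forall>x y. qform cs x y = (d \<bullet> x) * (d \<bullet> y) + qform ds x y"
    "\<forall>v\<in>set ds. v \<bullet> d = 0" "\<forall>x. qform cs x x \<le> (d \<bullet> d) * (x \<bullet> x)"
    "\<forall>w. (\<forall>v\<in>set cs. v \<bullet> w = 0) \<longrightarrow> d \<bullet> w = 0 \<and> (\<forall>v\<in>set ds. v \<bullet> w = 0)"
    "\<exists>e. norm e = 1 \<and> qform cs e e = d \<bullet> d" using qform_peel[of cs] by blast
  have oa: "b \<bullet> a = 0" "\<forall>v\<in>set bs. v \<bullet> a = 0" using B(4)[rule_format, of a] A(2) by auto
  have oa2: "c \<bullet> a = 0" "\<forall>v\<in>set cs. v \<bullet> a = 0" using C(4)[rule_format, of a] oa by auto
  have oa3: "d \<bullet> a = 0" "\<forall>v\<in>set ds. v \<bullet> a = 0" using D(4)[rule_format, of a] oa2 by auto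
  have ob: "c \<bullet> b = 0" "\<forall>v\<in>set cs. v \<bullet> b = 0" using C(4)[rule_format, of b] B(2) by auto
  have ob2: "d \<bullet> b = 0" "\<forall>v\<in>set ds. v \<bullet> b = 0" using D(4)[rule_format, of b] ob by auto
  have oc: "d \<bullet> c = 0" "\<forall>v\<in>set ds. v \<bullet> c = 0" using D(4)[rule_format, of c] C(2) by auto
  have le: "v \<bullet> v \<le> u \<bullet> u"
    if q: "\<And>x y. qform us x y = (v \<bullet> x) * (v \<bullet> y) + qform ws x y"
      and b: "\<And>x. qform us x x \<le> (u \<bullet> u) * (x \<bullet> x)" for us ws and u v :: "real^4"
  proof (cases "v = 0")
    case False
    have "(v \<bullet> v) * (v \<bullet> v) \<le> qform us v v" using q[of v v] qform_nonneg[of ws v] by simp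
    also have "\<dots> \<le> (u \<bullet> u) * (v \<bullet> v)" by (rule b)
    finally show ?thesis using False by (simp add: mult_le_cancel_right)
  qed simp
  have ab: "b \<bullet> b \<le> a \<bullet> a"
  proof (rule le[OF B(1)[rule_format]])
    fix x show "qform as x x \<le> (a \<bullet> a) * (x \<bullet> x)"
      using A(1)[rule_format, of x x] A(3)[rule_format, of x] zero_le_square[of "a \<bullet> x"] by linarith
  qed
  have bc: "c \<bullet> c \<le> b \<bullet> b"
  proof (rule le[OF C(1)[rule_format]])
    fix x show "qform bs x x \<le> (b \<bullet> b) * (x \<bullet> x)"
      using B(1)[rule_format, of x x] B(3)[rule_format, of x] zero_le_square[of "b \<bullet> x"] by linarith
  qed
  have cd: "d \<bullet> d \<le> c \<bullet> c"
  proof (rule le[OF D(1)[rule_format]])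
    fix x show "qform cs x x \<le> (c \<bullet> c) * (x \<bullet> x)"
      using C(1)[rule_format, of x x] C(3)[rule_format, of x] zero_le_square[of "c \<bullet> x"] by linarith
  qed
  have zero: "v = 0" if v: "v \<in> set ds" for v
  proof (rule ccontr)
    assume v0: "v \<noteq> 0"
    have "qform ds v v \<noteq> 0" using qform_zero[OF _ v, of v] v0 by auto
    hence "qform cs v v > 0" using D(1)[rule_format, of v v] qform_nonneg[of ds v] zero_le_square[of "d \<bullet> v"] by linarith
    hence "d \<bullet> d > 0" using D(3)[rule_format, of v] by (metis inner_ge_zero less_le_trans mult_zero_left less_eq_real_def)
    hence "d \<bullet> d > 0" "c \<bullet> c > 0" "b \<bullet> b > 0" "a \<bullet> a > 0" using ab bc cd by linarith+
    hence nz: "d \<noteq> 0" "c \<noteq> 0" "b \<noteq> 0" "a \<noteq> 0" by auto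
    have o: "v \<bullet> a = 0" "v \<bullet> b = 0" "v \<bullet> c = 0" "v \<bullet> d = 0" using v oa3 ob2 oc D(2) by auto
    have ne: "x \<noteq> y" if "x \<bullet> y = 0" "x \<noteq> 0" for x y :: "real^4" using that by auto
    have dist: "distinct [v, a, b, c, d]"
      using ne[OF o(1) v0] ne[OF o(2) v0] ne[OF o(3) v0] ne[OF o(4) v0] ne[OF oa(1)] ne[OF oa2(1)]
        ne[OF oa3(1)] ne[OF ob(1)] ne[OF ob2(1)] ne[OF oc(1)] nz by auto
    have "pairwise orthogonal {v, a, b, c, d}"
      using o oa(1) oa2(1) oa3(1) ob(1) ob2(1) oc(1)
      by (auto simp: pairwise_def orthogonal_def inner_commute)
    moreover have "0 \<notin> {v, a, b, c, d}" using nz v0 by auto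
    ultimately have "independent {v, a, b, c, d}" by (rule pairwise_orthogonal_independent)
    hence "card {v, a, b, c, d} \<le> 4" using independent_bound[of "{v, a, b, c, d}"] by simp
    moreover have "card {v, a, b, c, d} = 5" using dist distinct_card[OF dist] by simp
    ultimately show False by simp
  qed
  have "qform ds x y = 0" for x y by (rule qform_orth) (drule zero, simp)
  hence "qform vs x y = qform [a, b, c, d] x y" for x y using A(1) B(1) C(1) D(1) by simp
  thus ?thesis using that[of a b c d] ab bc cd oa(1) oa2(1) oa3(1) ob(1) ob2(1) oc(1) A(5)
    by (simp add: inner_commute)
qed

text \<open>The left-hand side depends only on the form, so the sum of squared lengths agrees for
  any two lists with the same form.\<close>

lemma qform_trace:
  fixes vs :: "(real^4) list"
  shows "(\<Sum>i\<in>UNIV. qform vs (axis i 1) (axis i 1)) = (\<Sum>v\<leftarrow>vs. v \<bullet> v)"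
proof -
  have *: "v \<bullet> axis i 1 = v $ i" for v :: "real^4" and i by (simp add: inner_axis)
  show ?thesis unfolding qform_def * inner_vec_def[of v v for v] by (induction vs) (simp_all add: sum.distrib)
qed

section \<open>Ensembles of complex vectors for a real form\<close>

text \<open>A pair \<open>(a, b)\<close> in these lists stands for the complex vector \<open>a + i b\<close>; \<open>pskew\<close> is the
  imaginary part of the associated Hermitian form, and \<open>pcost\<close> is the sum of the \<open>|y \<bullet> y|\<close> for the
  complex bilinear extension of the inner product.\<close>

definition pform :: "('a::real_inner \<times> 'a) list \<Rightarrow> 'a \<Rightarrow> 'a \<Rightarrow> real" where
  "pform ps x y = (\<Sum>(a, b)\<leftarrow>ps. (a \<bullet> x) * (a \<bullet> y) + (b \<bullet> x) * (b \<bullet> y))"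

definition pskew :: "('a::real_inner \<times> 'a) list \<Rightarrow> 'a \<Rightarrow> 'a \<Rightarrow> real" where
  "pskew ps x y = (\<Sum>(a, b)\<leftarrow>ps. (b \<bullet> x) * (a \<bullet> y) - (a \<bullet> x) * (b \<bullet> y))"

definition pcost :: "('a::real_inner \<times> 'a) list \<Rightarrow> real" where
  "pcost ps = (\<Sum>(a, b)\<leftarrow>ps. cmod (Complex (a \<bullet> a - b \<bullet> b) (2 * (a \<bullet> b))))"

lemma pform_simps [simp]:
  "pform [] x y = 0"
  "pform ((a, b) # ps) x y = (a \<bullet> x) * (a \<bullet> y) + (b \<bullet> x) * (b \<bullet> y) + pform ps x y"
  "pform (ps @ qs) x y = pform ps x y + pform qs x y"
  by (simp_all add: pform_def)

lemma pskew_simps [simp]: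
  "pskew [] x y = 0"
  "pskew ((a, b) # ps) x y = (b \<bullet> x) * (a \<bullet> y) - (a \<bullet> x) * (b \<bullet> y) + pskew ps x y"
  "pskew (ps @ qs) x y = pskew ps x y + pskew qs x y"
  by (simp_all add: pskew_def)

lemma pcost_simps [simp]:
  "pcost [] = 0"
  "pcost ((a, b) # ps) = cmod (Complex (a \<bullet> a - b \<bullet> b) (2 * (a \<bullet> b))) + pcost ps"
  "pcost (ps @ qs) = pcost ps + pcost qs"
  by (simp_all add: pcost_def)

text \<open>Split \<open>a\<close> into pieces proportional to the lengths of the vectors b and pair
  each piece with both signs of i b / sqrt 2. The two signs cancel the cross and skew terms. By
  orthogonality all values y \<bullet> y are real and of one sign, so their moduli add up to the
  modulus of the total.\<close>

lemma block_ensemble: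
  fixes a :: "'a::real_inner" and bs :: "'a list"
  assumes orth: "\<And>b. b \<in> set bs \<Longrightarrow> a \<bullet> b = 0"
  obtains ps where "\<And>x y. pform ps x y = qform (a # bs) x y" and "\<And>x y. pskew ps x y = 0"
    and "pcost ps = \<bar>a \<bullet> a - (\<Sum>b\<leftarrow>bs. b \<bullet> b)\<bar>"
proof -
  define T where "T = (\<Sum>b\<leftarrow>bs. b \<bullet> b)"
  have nn: "(\<Sum>b\<leftarrow>bs. b \<bullet> b) \<ge> 0" for bs :: "'a list" by (induction bs) simp_all
  show ?thesis
  proof (cases "T = 0")
    case True
    have z: "b = 0" if "b \<in> set bs" for b
      using that True unfolding T_def
    proof (induction bs)
      case (Cons c bs)
      thus ?case using nn[of bs] inner_ge_zero[of c] by (auto simp: add_nonneg_eq_0_iff)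
    qed simp
    have "qform bs x y = 0" for x y by (rule qform_orth) (drule z, simp)
    thus ?thesis using that[of "[(a, 0)]"] True
      by (simp add: pform_def pskew_def pcost_def T_def[symmetric] cmod_def)
  next
    case False
    hence T: "T > 0" using nn[of bs] by (simp add: T_def)
    \<comment> \<open>The weights |b|^2 / (2 T), counted for both signs, sum to one, so the pieces
      restore the form of \<open>a\<close>.\<close>
    define f where "f b = (norm b / sqrt (2 * T)) *\<^sub>R a" for b :: 'a
    define g where "g b = (1 / sqrt 2) *\<^sub>R b" for b :: 'a
    define ps where "ps = map (\<lambda>b. (f b, g b)) bs @ map (\<lambda>b. (f b, - g b)) bs"
    have f2: "(f b \<bullet> x) * (f b \<bullet> y) = (b \<bullet> b) / (2 * T) * ((a \<bullet> x) * (a \<bullet> y))" for b x y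
      using T by (simp add: f_def field_simps power2_norm_eq_inner[symmetric] power2_eq_square)
    have g2: "(g b \<bullet> x) * (g b \<bullet> y) = (b \<bullet> x) * (b \<bullet> y) / 2" for b x y
      by (simp add: g_def)
    have "pform ps x y = (\<Sum>b\<leftarrow>bs. b \<bullet> b) / T * ((a \<bullet> x) * (a \<bullet> y)) + qform bs x y" for x y
      unfolding ps_def by (induction bs) (simp_all add: f2 g2 add_divide_distrib algebra_simps)
    hence 1: "pform ps x y = qform (a # bs) x y" for x y using T by (simp add: T_def)
    have 2: "pskew ps x y = 0" for x y
      unfolding ps_def by (induction bs) (simp_all add: algebra_simps)
    have fg: "f b \<bullet> g b = 0" if "b \<in> set bs" for b using orth[OF that] by (simp add: f_def g_def)
    have aa: "sqrt (2 * T) * sqrt (2 * T) = 2 * T" using T by simp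
    have ff: "f b \<bullet> f b - g b \<bullet> g b = (b \<bullet> b) * ((a \<bullet> a - T) / (2 * T))" for b
    proof -
      have "f b \<bullet> f b = (norm b * norm b) / (sqrt (2 * T) * sqrt (2 * T)) * (a \<bullet> a)" by (simp add: f_def)
      moreover have "g b \<bullet> g b = (b \<bullet> b) / 2" by (simp add: g_def)
      ultimately show ?thesis using T unfolding aa
        by (simp add: power2_norm_eq_inner[symmetric] field_simps power2_eq_square)
    qed
    have c1: "cmod (Complex (f b \<bullet> f b - g b \<bullet> g b) (2 * (f b \<bullet> g b))) = (b \<bullet> b) * (\<bar>a \<bullet> a - T\<bar> / (2*T))"
      and c2: "cmod (Complex (f b \<bullet> f b - (- g b) \<bullet> (- g b)) (2 * (f b \<bullet> (- g b)))) = (b \<bullet> b) * (\<bar>a \<bullet> a - T\<bar> / (2*T))"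
      if "b \<in> set bs" for b
      using T unfolding inner_minus_left inner_minus_right minus_minus ff fg[OF that]
      by (simp_all add: cmod_def abs_mult)
    have "pcost (map (\<lambda>b. (f b, g b)) cs) + pcost (map (\<lambda>b. (f b, - g b)) cs)
        = (\<Sum>b\<leftarrow>cs. (b \<bullet> b) * (\<bar>a \<bullet> a - T\<bar> / T))" if "set cs \<subseteq> set bs" for cs
      using that
    proof (induction cs)
      case (Cons c cs)
      hence "c \<in> set bs" by simp
      from c1[OF this] c2[OF this] show ?case using Cons by (simp del: inner_minus_left inner_minus_right)
    qed simp
    from this[of bs] have "pcost ps = (\<Sum>b\<leftarrow>bs. (b \<bullet> b) * (\<bar>a \<bullet> a - T\<bar> / T))" by (simp add: ps_def)
    also have "\<dots> = T * (\<bar>a \<bullet> a - T\<bar> / T)" unfolding sum_list_mult_const T_def[symmetric] by simp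
    finally have "pcost ps = \<bar>a \<bullet> a - (\<Sum>b\<leftarrow>bs. b \<bullet> b)\<bar>" using T by (simp add: T_def)
    thus ?thesis using that[of ps] 1 2 by blast
  qed
qed

text \<open>Wootters' decomposition for a real positive form.  If the largest eigenvalue exceeds the sum of
  the others, one block gives the cost; otherwise the form is a sum of three blocks of cost zero.\<close>

lemma real_form_ensemble:
  fixes vs :: "(real^4) list"
  shows "\<exists>ps e. norm e = 1 \<and> (\<forall>x y. pform ps x y = qform vs x y) \<and> (\<forall>x y. pskew ps x y = 0) \<and>
    pcost ps \<le> max 0 (2 * qform vs e e - (\<Sum>v\<leftarrow>vs. v \<bullet> v))"
proof -
  obtain a b c d where G: "\<And>x y. qform vs x y = qform [a, b, c, d] x y"
    and o: "a \<bullet> b = 0" "a \<bullet> c = 0" "a \<bullet> d = 0" "b \<bullet> c = 0" "b \<bullet> d = 0" "c \<bullet> d = 0"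
    and le: "b \<bullet> b \<le> a \<bullet> a" "c \<bullet> c \<le> b \<bullet> b" "d \<bullet> d \<le> c \<bullet> c"
    and "\<exists>e. norm e = 1 \<and> qform vs e e = a \<bullet> a"
    using qform_spectral4[of vs] by metis
  then obtain e where e: "norm e = 1" "qform vs e e = a \<bullet> a" by blast
  have tr: "(\<Sum>v\<leftarrow>vs. v \<bullet> v) = a \<bullet> a + b \<bullet> b + c \<bullet> c + d \<bullet> d"
    unfolding qform_trace[symmetric] G unfolding qform_trace by simp
  show ?thesis
  proof (cases "a \<bullet> a \<ge> b \<bullet> b + c \<bullet> c + d \<bullet> d")
    case True
    obtain ps where "\<And>x y. pform ps x y = qform (a # [b, c, d]) x y" "\<And>x y. pskew ps x y = 0"
      "pcost ps = \<bar>a \<bullet> a - (\<Sum>b\<leftarrow>[b, c, d]. b \<bullet> b)\<bar>"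
      by (rule block_ensemble[of "[b, c, d]" a]) (use o in auto)
    thus ?thesis using e G tr True by (intro exI[of _ ps] exI[of _ e]) simp
  next
    case False
    define t where "t = c \<bullet> c + d \<bullet> d"
    \<comment> \<open>x is the part of |a|^2 balanced against an equal part of |b|^2; the two
      remainders have total mass t and are balanced against c and d. The eigenvalue ordering and the
      failed case condition keep x in range.\<close>
    define x where "x = (a \<bullet> a + b \<bullet> b - t) / 2"
    have nn: "c \<bullet> c \<ge> 0" "d \<bullet> d \<ge> 0" by simp_all
    have t: "t > 0" using False le(1) by (simp add: t_def)
    have b: "b \<bullet> b > 0" using t le nn unfolding t_def by linarith
    have a: "a \<bullet> a > 0" using b le by linarith
    have x: "0 \<le> x" "x \<le> b \<bullet> b" "x \<le> a \<bullet> a" "(a \<bullet> a - x) + (b \<bullet> b - x) = t"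
      using False le unfolding x_def t_def by (auto simp: field_simps)
    define r where "r u v = sqrt (u / v)" for u v :: real
    have r: "r u v * r u v = u / v" if "u \<ge> 0" "v > 0" for u v using that by (simp add: r_def)
    obtain ps1 where 1: "\<And>y z. pform ps1 y z = qform (r x (a \<bullet> a) *\<^sub>R a # [r x (b \<bullet> b) *\<^sub>R b]) y z"
      "\<And>x y. pskew ps1 x y = 0"
      "pcost ps1 = \<bar>(r x (a \<bullet> a) *\<^sub>R a) \<bullet> (r x (a \<bullet> a) *\<^sub>R a) - (\<Sum>b\<leftarrow>[r x (b \<bullet> b) *\<^sub>R b]. b \<bullet> b)\<bar>"
      by (rule block_ensemble[of "[r x (b \<bullet> b) *\<^sub>R b]" "r x (a \<bullet> a) *\<^sub>R a"]) (use o in auto)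
    obtain ps2 where 2: "\<And>y z. pform ps2 y z = qform (r (a \<bullet> a - x) (a \<bullet> a) *\<^sub>R a # [r (a \<bullet> a - x) t *\<^sub>R c, r (a \<bullet> a - x) t *\<^sub>R d]) y z"
      "\<And>x y. pskew ps2 x y = 0"
      "pcost ps2 = \<bar>(r (a \<bullet> a - x) (a \<bullet> a) *\<^sub>R a) \<bullet> (r (a \<bullet> a - x) (a \<bullet> a) *\<^sub>R a) - (\<Sum>b\<leftarrow>[r (a \<bullet> a - x) t *\<^sub>R c, r (a \<bullet> a - x) t *\<^sub>R d]. b \<bullet> b)\<bar>"
      by (rule block_ensemble[of "[r (a \<bullet> a - x) t *\<^sub>R c, r (a \<bullet> a - x) t *\<^sub>R d]" "r (a \<bullet> a - x) (a \<bullet> a) *\<^sub>R a"]) (use o in auto)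
    obtain ps3 where 3: "\<And>y z. pform ps3 y z = qform (r (b \<bullet> b - x) (b \<bullet> b) *\<^sub>R b # [r (b \<bullet> b - x) t *\<^sub>R c, r (b \<bullet> b - x) t *\<^sub>R d]) y z"
      "\<And>x y. pskew ps3 x y = 0"
      "pcost ps3 = \<bar>(r (b \<bullet> b - x) (b \<bullet> b) *\<^sub>R b) \<bullet> (r (b \<bullet> b - x) (b \<bullet> b) *\<^sub>R b) - (\<Sum>b\<leftarrow>[r (b \<bullet> b - x) t *\<^sub>R c, r (b \<bullet> b - x) t *\<^sub>R d]. b \<bullet> b)\<bar>"
      by (rule block_ensemble[of "[r (b \<bullet> b - x) t *\<^sub>R c, r (b \<bullet> b - x) t *\<^sub>R d]" "r (b \<bullet> b - x) (b \<bullet> b) *\<^sub>R b"]) (use o in auto)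
    have s: "(s *\<^sub>R w) \<bullet> y * ((s *\<^sub>R w) \<bullet> z) = s * s * ((w \<bullet> y) * (w \<bullet> z))" for s and w y z :: "real^4" by simp
    have s': "(s *\<^sub>R w) \<bullet> (s *\<^sub>R w) = s * s * (w \<bullet> w)" for s and w :: "real^4" by simp
    have k: "k * (c \<bullet> c) / t + k * (d \<bullet> d) / t = k" for k
      using t by (simp add: add_divide_distrib[symmetric] distrib_left[symmetric] t_def[symmetric])
    have "pcost ps1 = 0" using a b x unfolding 1(3) by (simp add: s' r del: inner_scaleR_left inner_scaleR_right)
    moreover have "pcost ps2 = 0" using a b x t unfolding 2(3)
      by (simp add: s' r k del: inner_scaleR_left inner_scaleR_right)
    moreover have "pcost ps3 = 0" using a b x t unfolding 3(3)
      by (simp add: s' r k del: inner_scaleR_left inner_scaleR_right)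
    moreover have "pform (ps1 @ ps2 @ ps3) y z = qform vs y z" for y z
    proof -
      have xa: "x / (a \<bullet> a) + (a \<bullet> a - x) / (a \<bullet> a) = 1" "x / (b \<bullet> b) + (b \<bullet> b - x) / (b \<bullet> b) = 1"
        "(a \<bullet> a - x) / t + (b \<bullet> b - x) / t = 1"
        using a b t x(4) by (simp_all add: add_divide_distrib[symmetric])
      have "pform (ps1 @ ps2 @ ps3) y z = (x / (a \<bullet> a) + (a \<bullet> a - x) / (a \<bullet> a)) * ((a \<bullet> y) * (a \<bullet> z))
         + (x / (b \<bullet> b) + (b \<bullet> b - x) / (b \<bullet> b)) * ((b \<bullet> y) * (b \<bullet> z))
         + ((a \<bullet> a - x) / t + (b \<bullet> b - x) / t) * ((c \<bullet> y) * (c \<bullet> z))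
         + ((a \<bullet> a - x) / t + (b \<bullet> b - x) / t) * ((d \<bullet> y) * (d \<bullet> z))"
        using a b x t unfolding pform_simps 1(1) 2(1) 3(1) qform_simps s
        by (simp add: r algebra_simps)
      thus ?thesis unfolding xa G by simp
    qed
    ultimately show ?thesis using e 1(2) 2(2) 3(2)
      by (intro exI[of _ "ps1 @ ps2 @ ps3"] exI[of _ e]) simp
  qed
qed

section \<open>Two-by-two complex matrices\<close>

definition dag :: "complex^2^2 \<Rightarrow> complex^2^2" where
  "dag A = (\<chi> i j. cnj (A $ j $ i))"

lemma dag_nth [simp]: "dag A $ i $ j = cnj (A $ j $ i)"
  by (simp add: dag_def)

lemma mat2_eq_iff: "(A :: 'a^2^2) = B \<longleftrightarrow> A$1$1 = B$1$1 \<and> A$1$2 = B$1$2 \<and> A$2$1 = B$2$1 \<and> A$2$2 = B$2$2"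
  by (auto simp: vec_eq_iff forall_2)

lemma mat2_mult_nth: "((A :: complex^2^2) ** B) $ i $ j = A$i$1 * B$1$j + A$i$2 * B$2$j"
  by (simp add: matrix_matrix_mult_def sum_2)

lemma trace2: "trace (A :: complex^2^2) = A$1$1 + A$2$2"
  by (simp add: trace_def sum_2)

lemma dag_mult: "dag (A ** B) = dag B ** dag A"
  by (simp add: mat2_eq_iff mat2_mult_nth)

lemma dag_dag [simp]: "dag (dag A) = A"
  by (simp add: mat2_eq_iff)

lemma dag_add: "dag (A + B) = dag A + dag B"
  by (simp add: mat2_eq_iff)

lemma dag_mat1 [simp]: "dag (mat 1) = mat 1"
  by (simp add: mat2_eq_iff mat_def)

lemma det_dag: "det (dag A) = cnj (det A)"
  by (simp add: det_2)

lemma mult_cnj_cmod: "z * cnj z = of_real ((cmod z)\<^sup>2)"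
  by (rule complex_norm_square[symmetric])

lemma Re_det_conj: "Re (det (A ** P ** dag A)) = (cmod (det A))\<^sup>2 * Re (det P)"
proof -
  have "det (A ** P ** dag A) = (det A * cnj (det A)) * det P" by (simp add: det_mul det_dag)
  thus ?thesis unfolding mult_cnj_cmod by (simp del: of_real_power)
qed

section \<open>Hermitian matrices in Pauli coordinates\<close>

text \<open>t times the identity plus the Pauli combination of the Bloch vector (x, y, z); the
  determinant becomes the Lorentz form.\<close>

definition herm :: "real \<Rightarrow> real \<Rightarrow> real \<Rightarrow> real \<Rightarrow> complex^2^2" where
  "herm t x y z = vector [vector [Complex (t + z) 0, Complex x (- y)], vector [Complex x y, Complex (t - z) 0]]"

lemma herm_nth [simp]:
  "herm t x y z $ 1 $ 1 = Complex (t + z) 0" "herm t x y z $ 1 $ 2 = Complex x (- y)"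
  "herm t x y z $ 2 $ 1 = Complex x y" "herm t x y z $ 2 $ 2 = Complex (t - z) 0"
  by (simp_all add: herm_def)

lemma herm_eq_iff: "herm t x y z = herm t' x' y' z' \<longleftrightarrow> t = t' \<and> x = x' \<and> y = y' \<and> z = z'"
  by (auto simp: mat2_eq_iff)

lemma dag_herm [simp]: "dag (herm t x y z) = herm t x y z"
  by (simp add: mat2_eq_iff complex_eq_iff)

lemma self_adjoint_herm:
  assumes "dag A = A"
  shows "A = herm ((Re (A$1$1) + Re (A$2$2)) / 2) (Re (A$2$1)) (Im (A$2$1)) ((Re (A$1$1) - Re (A$2$2)) / 2)"
proof -
  have "cnj (A$1$1) = A$1$1" "cnj (A$2$2) = A$2$2" "cnj (A$2$1) = A$1$2"
    using assms dag_nth[of A] by metis+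
  hence "Im (A$1$1) = 0" "Im (A$2$2) = 0" "Re (A$1$2) = Re (A$2$1)" "Im (A$1$2) = - Im (A$2$1)"
    by (auto simp: complex_eq_iff)
  thus ?thesis by (simp add: mat2_eq_iff complex_eq_iff field_simps)
qed

lemma herm_cases:
  assumes "dag A = A" obtains t x y z where "A = herm t x y z"
  using self_adjoint_herm[OF assms] by blast

lemma herm_add: "herm t x y z + herm t' x' y' z' = herm (t + t') (x + x') (y + y') (z + z')"
  by (simp add: mat2_eq_iff complex_eq_iff)

lemma herm_scale: "c *\<^sub>R herm t x y z = herm (c * t) (c * x) (c * y) (c * z)"
  by (simp add: mat2_eq_iff complex_eq_iff algebra_simps)

lemma mat1_herm: "mat 1 = herm 1 0 0 0"
  by (simp add: mat2_eq_iff mat_def complex_eq_iff)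

lemma det_herm: "det (herm t x y z) = of_real (t\<^sup>2 - (x\<^sup>2 + y\<^sup>2 + z\<^sup>2))"
  by (simp add: det_2 complex_eq_iff power2_eq_square algebra_simps)

lemma trace_herm: "trace (herm t x y z) = of_real (2 * t)"
  by (simp add: trace2 complex_eq_iff)

lemma mat2_scale_mult: "(c *\<^sub>R A) ** B = c *\<^sub>R (A ** B)" "A ** (c *\<^sub>R B) = c *\<^sub>R ((A :: complex^2^2) ** (B :: complex^2^2))"
  by (simp_all add: mat2_eq_iff mat2_mult_nth scaleR_add_right)

lemma mat2_add_mult: "(A + A') ** B = A ** B + A' ** B" "A ** (B + B') = A ** B + (A :: complex^2^2) ** (B' :: complex^2^2)"
  by (simp_all add: mat2_eq_iff mat2_mult_nth algebra_simps)

section \<open>Completely positive maps and ensembles\<close>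

text \<open>The completely positive map L of the overview, given by its Kraus operators.\<close>

definition chan :: "(complex^2^2) list \<Rightarrow> complex^2^2 \<Rightarrow> complex^2^2" where
  "chan Xs P = (\<Sum>X\<leftarrow>Xs. X ** P ** dag X)"

lemma chan_simps [simp]: "chan [] P = 0" "chan (X # Xs) P = X ** P ** dag X + chan Xs P"
  by (simp_all add: chan_def)

lemma chan_map: "chan (map (\<lambda>X. A ** X ** B) Xs) P = A ** chan Xs (B ** P ** dag B) ** dag A"
proof (induction Xs)
  case Nil show ?case by (simp add: mat2_eq_iff mat2_mult_nth)
next
  case (Cons X Xs)
  thus ?case by (simp add: mat2_add_mult dag_mult matrix_mul_assoc)
qed

lemma chan_add: "chan Xs (P + Q) = chan Xs P + chan Xs Q"
  by (induction Xs) (simp_all add: mat2_add_mult algebra_simps)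

lemma chan_scale: "chan Xs (c *\<^sub>R P) = c *\<^sub>R chan Xs P"
  by (induction Xs) (simp_all add: mat2_scale_mult scaleR_add_right)

lemma dag_chan: "dag (chan Xs P) = chan Xs (dag P)"
proof (induction Xs)
  case Nil show ?case by (simp add: mat2_eq_iff)
next
  case (Cons X Xs)
  thus ?case by (simp add: dag_add dag_mult matrix_mul_assoc)
qed

lemma dag_conj_self_adjoint: "dag P = P \<Longrightarrow> dag (A ** P ** dag A) = A ** P ** dag A"
  by (simp add: dag_mult matrix_mul_assoc)

text \<open>Matrices are read as vectors of the pair AB; both lists are then unnormalised ensembles
  of one state.\<close>

definition same_ens :: "(complex^2^2) list \<Rightarrow> (complex^2^2) list \<Rightarrow> bool" where
  "same_ens Xs Ys \<longleftrightarrow> (\<forall>i j k l. (\<Sum>X\<leftarrow>Xs. X$i$j * cnj (X$k$l)) = (\<Sum>Y\<leftarrow>Ys. Y$i$j * cnj (Y$k$l)))"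

text \<open>Second moments of linear images are determined by the second moments of the entries;
  this makes \<open>same_ens\<close> stable under filters and changes of basis.\<close>

lemma sum_list_expand_prod:
  fixes f g :: "'a \<Rightarrow> 'b::finite \<Rightarrow> complex"
  shows "(\<Sum>X\<leftarrow>Xs. (\<Sum>a\<in>UNIV. c a * f X a) * cnj (\<Sum>b\<in>UNIV. d b * g X b))
    = (\<Sum>a\<in>UNIV. \<Sum>b\<in>UNIV. c a * cnj (d b) * (\<Sum>X\<leftarrow>Xs. f X a * cnj (g X b)))"
proof (induction Xs)
  case (Cons X Xs)
  have "(\<Sum>a\<in>UNIV. c a * f X a) * cnj (\<Sum>b\<in>UNIV. d b * g X b)
      = (\<Sum>a\<in>UNIV. \<Sum>b\<in>UNIV. c a * cnj (d b) * (f X a * cnj (g X b)))"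
    by (simp add: sum_product algebra_simps)
  thus ?case using Cons by (simp add: sum.distrib distrib_left)
qed simp

lemma same_ens_map:
  assumes "same_ens Xs Ys"
  shows "same_ens (map (\<lambda>X. A ** X ** B) Xs) (map (\<lambda>X. A ** X ** B) Ys)"
proof -
  have e: "(A ** X ** B) $ i $ j = (\<Sum>a\<in>UNIV. A $ i $ fst a * B $ snd a $ j * X $ fst a $ snd a)"
    for X :: "complex^2^2" and i j
    by (simp add: UNIV_Times_UNIV[symmetric] sum.cartesian_product' sum_2 mat2_mult_nth algebra_simps
        del: UNIV_Times_UNIV)
  show ?thesis
    unfolding same_ens_def map_map comp_def e
    unfolding sum_list_expand_prod[where f="\<lambda>X a. X $ fst a $ snd a" and g="\<lambda>X a. X $ fst a $ snd a"]
      assms[unfolded same_ens_def, rule_format] by blast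
qed

section \<open>Gram determinants\<close>

text \<open>The Gram determinant of the two rows whose columns are the listed pairs. For the
  amplitudes of a qubit and a second system it is a quarter of the squared concurrence.\<close>

definition gdet :: "(complex \<times> complex) list \<Rightarrow> real" where
  "gdet vs = (\<Sum>(a, b)\<leftarrow>vs. (cmod a)\<^sup>2) * (\<Sum>(a, b)\<leftarrow>vs. (cmod b)\<^sup>2)
    - (cmod (\<Sum>(a, b)\<leftarrow>vs. a * cnj b))\<^sup>2"

definition wsum :: "complex \<times> complex \<Rightarrow> (complex \<times> complex) list \<Rightarrow> real" where
  "wsum v vs = (\<Sum>(c, d)\<leftarrow>vs. (cmod (fst v * d - snd v * c))\<^sup>2)"

lemma wsum_nonneg: "wsum v vs \<ge> 0"
  by (auto simp: wsum_def intro!: sum_list_nonneg)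

lemma cmod_sq: "(cmod z)\<^sup>2 = (Re z)\<^sup>2 + (Im z)\<^sup>2"
  by (simp add: cmod_def)

lemma wsum_expand: "wsum (a, b) vs = (cmod a)\<^sup>2 * (\<Sum>(c, d)\<leftarrow>vs. (cmod d)\<^sup>2)
    + (cmod b)\<^sup>2 * (\<Sum>(c, d)\<leftarrow>vs. (cmod c)\<^sup>2) - 2 * Re (a * cnj b * cnj (\<Sum>(c, d)\<leftarrow>vs. c * cnj d))"
proof (induction vs)
  case (Cons v vs)
  obtain c d where v: "v = (c, d)" by force
  have "(cmod (a * d - b * c))\<^sup>2 = (cmod a)\<^sup>2 * (cmod d)\<^sup>2 + (cmod b)\<^sup>2 * (cmod c)\<^sup>2
      - 2 * Re (a * cnj b * cnj (c * cnj d))"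
    unfolding cmod_sq by (simp add: power2_eq_square algebra_simps)
  thus ?case using Cons by (simp add: v wsum_def algebra_simps)
qed (simp add: wsum_def)

text \<open>Lagrange's identity, one column at a time: the Gram determinant is the sum of the
  squared moduli of all two-by-two minors. Nonnegativity, and collinearity when it vanishes, are
  read off from this.\<close>

lemma gdet_Cons: "gdet (v # vs) = gdet vs + wsum v vs"
proof -
  obtain a b where v: "v = (a, b)" by force
  have "(cmod (a * cnj b + S))\<^sup>2 = (cmod a)\<^sup>2 * (cmod b)\<^sup>2 + (cmod S)\<^sup>2 + 2 * Re (a * cnj b * cnj S)" for S
    unfolding cmod_sq by (simp add: power2_eq_square algebra_simps)
  from this[of "\<Sum>(a, b)\<leftarrow>vs. a * cnj b"] show ?thesis
    unfolding v wsum_expand gdet_def by (simp add: distrib_left distrib_right del: times_complex.sel)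
qed

lemma gdet_nonneg: "gdet vs \<ge> 0"
proof (induction vs)
  case Nil thus ?case by (simp add: gdet_def)
next
  case (Cons v vs) thus ?case using wsum_nonneg[of v vs] by (simp add: gdet_Cons)
qed

lemma gdet_append: "gdet (us @ vs) = gdet us + gdet vs + (\<Sum>u\<leftarrow>us. wsum u vs)"
  by (induction us) (simp_all add: gdet_Cons gdet_def[of "[]"] wsum_def)

lemma wsum_zero: "wsum v vs = 0 \<Longrightarrow> w \<in> set vs \<Longrightarrow> fst v * snd w = snd v * fst w"
proof (induction vs)
  case (Cons u vs)
  have "wsum v (u # vs) = (cmod (fst v * snd u - snd v * fst u))\<^sup>2 + wsum v vs"
    by (simp add: wsum_def split: prod.splits)
  hence "(cmod (fst v * snd u - snd v * fst u))\<^sup>2 = 0" "wsum v vs = 0"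
    using Cons.prems(1) wsum_nonneg[of v vs] zero_le_power2[of "cmod (fst v * snd u - snd v * fst u)"] by linarith+
  thus ?case using Cons by auto
qed simp

lemma gdet_zero:
  "gdet vs = 0 \<Longrightarrow> v \<in> set vs \<Longrightarrow> w \<in> set vs \<Longrightarrow> fst v * snd w = snd v * fst w"
proof (induction vs arbitrary: v w)
  case (Cons u vs)
  have z: "gdet vs = 0" "wsum u vs = 0"
    using Cons.prems(1) gdet_nonneg[of vs] wsum_nonneg[of u vs] by (auto simp: gdet_Cons)
  consider "v = u" "w = u" | "v = u" "w \<in> set vs" | "v \<in> set vs" "w = u" | "v \<in> set vs" "w \<in> set vs"
    using Cons.prems by auto
  thus ?case
  proof cases
    case 3 thus ?thesis using wsum_zero[OF z(2), of v] by (simp add: mult.commute)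
  qed (use Cons.IH[OF z(1)] wsum_zero[OF z(2)] in \<open>simp_all add: mult.commute\<close>)
qed simp

definition app :: "complex \<Rightarrow> complex \<Rightarrow> complex^2^2 \<Rightarrow> complex \<times> complex" where
  "app p q X = (X$1$1 * p + X$1$2 * q, X$2$1 * p + X$2$2 * q)"

definition outer :: "complex \<Rightarrow> complex \<Rightarrow> complex^2^2" where
  "outer p q = vector [vector [p * cnj p, p * cnj q], vector [q * cnj p, q * cnj q]]"

lemma outer_nth [simp]:
  "outer p q $ 1 $ 1 = p * cnj p" "outer p q $ 1 $ 2 = p * cnj q"
  "outer p q $ 2 $ 1 = q * cnj p" "outer p q $ 2 $ 2 = q * cnj q"
  by (simp_all add: outer_def)

definition gmat :: "(complex \<times> complex) list \<Rightarrow> complex^2^2" where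
  "gmat vs = (\<Sum>(a, b)\<leftarrow>vs. outer a b)"

lemma gmat_simps [simp]: "gmat [] = 0" "gmat ((a, b) # vs) = outer a b + gmat vs"
  "gmat (us @ vs) = gmat us + gmat vs"
  by (simp_all add: gmat_def)

lemma gmat_nth:
  "gmat vs $ 1 $ 1 = of_real (\<Sum>(a, b)\<leftarrow>vs. (cmod a)\<^sup>2)"
  "gmat vs $ 2 $ 2 = of_real (\<Sum>(a, b)\<leftarrow>vs. (cmod b)\<^sup>2)"
  "gmat vs $ 1 $ 2 = (\<Sum>(a, b)\<leftarrow>vs. a * cnj b)"
  "gmat vs $ 2 $ 1 = cnj (\<Sum>(a, b)\<leftarrow>vs. a * cnj b)"
  by (induction vs) (auto simp: mult_cnj_cmod)

lemma det_gmat: "det (gmat vs) = of_real (gdet vs)"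
  unfolding det_2 gmat_nth gdet_def mult_cnj_cmod by simp

text \<open>The projector on v = (p, q) goes to the Gram matrix of the vectors X v, so the
  determinant of its image is the \<open>gdet\<close> of the branch of B belonging to v.\<close>

lemma chan_outer: "chan Xs (outer p q) = gmat (map (app p q) Xs)"
proof (induction Xs)
  case (Cons X Xs)
  have "X ** outer p q ** dag X = outer (fst (app p q X)) (snd (app p q X))"
    by (simp add: mat2_eq_iff mat2_mult_nth app_def algebra_simps)
  moreover have "gmat (v # vs) = outer (fst v) (snd v) + gmat vs" for v vs by (cases v) simp
  ultimately show ?case using Cons by simp
qed simp

lemma outer_complete:
  assumes "(cmod p)\<^sup>2 + (cmod q)\<^sup>2 = 1"
  shows "outer p q + outer (- cnj q) (cnj p) = mat 1"
proof -
  have "p * cnj p + q * cnj q = of_real 1"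
    unfolding mult_cnj_cmod of_real_add[symmetric] assms ..
  thus ?thesis by (simp add: mat2_eq_iff mat_def algebra_simps)
qed

text \<open>The identity splits along any orthonormal basis of B, so the right-hand side does not
  depend on the basis.\<close>

lemma det_chan_mat1:
  assumes "(cmod p)\<^sup>2 + (cmod q)\<^sup>2 = 1"
  shows "det (chan Xs (mat 1)) = of_real (gdet (map (app p q) Xs @ map (app (- cnj q) (cnj p)) Xs))"
  unfolding outer_complete[OF assms, symmetric] chan_add chan_outer det_gmat[symmetric] gmat_simps ..

lemma rank_one_herm:
  assumes "x\<^sup>2 + y\<^sup>2 + z\<^sup>2 = (1::real)"
  obtains p q where "(cmod p)\<^sup>2 + (cmod q)\<^sup>2 = 1" "herm 1 x y z = 2 *\<^sub>R outer p q"
\<comment> \<open>At the south pole the first component, sqrt ((1 + z) / 2), vanishes and cannot be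
  divided by.\<close>
proof (cases "z = -1")
  case True
  hence "x = 0" "y = 0" using assms by (auto simp: sum_power2_eq_zero_iff)
  thus ?thesis using that[of 0 1] True by (simp add: mat2_eq_iff complex_eq_iff)
next
  case False
  have "z\<^sup>2 \<le> 1" using assms zero_le_power2[of x] zero_le_power2[of y] by linarith
  hence "z > -1" using False by (simp add: abs_square_le_1)
  define r where "r = sqrt ((1 + z) / 2)"
  have r: "r > 0" "r\<^sup>2 = (1 + z) / 2" using \<open>z > -1\<close> by (simp_all add: r_def)
  define q where "q = Complex (x / (2 * r)) (y / (2 * r))"
  have "(Re q)\<^sup>2 + (Im q)\<^sup>2 = (x\<^sup>2 + y\<^sup>2) / (4 * r\<^sup>2)"
    by (simp add: q_def power_divide add_divide_distrib power_mult_distrib)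
  also have "x\<^sup>2 + y\<^sup>2 = (1 - z) * (1 + z)" using assms by (simp add: power2_eq_square algebra_simps)
  also have "(1 - z) * (1 + z) / (4 * r\<^sup>2) = (1 - z) / 2" using \<open>z > -1\<close> by (simp add: r field_simps)
  finally have q: "(Re q)\<^sup>2 + (Im q)\<^sup>2 = (1 - z) / 2" .
  show ?thesis
  proof (rule that[of "of_real r" q])
    show "(cmod (complex_of_real r))\<^sup>2 + (cmod q)\<^sup>2 = 1" using r q by (simp add: cmod_sq field_simps)
    have rr: "r * r = (1 + z) / 2" "Re q * Re q + Im q * Im q = (1 - z) / 2"
      using r q by (simp_all add: power2_eq_square)
    have rq: "r * Re q = x / 2" "r * Im q = y / 2" "Re q * r = x / 2" "Im q * r = y / 2"
      using r(1) by (simp_all add: q_def)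
    show "herm 1 x y z = 2 *\<^sub>R outer (of_real r) q"
      by (simp add: mat2_eq_iff complex_eq_iff rr rq)
  qed
qed

section \<open>Filtering to a unital and trace-preserving map\<close>

text \<open>In Pauli coordinates these matrices fill the open forward light cone.\<close>

definition pos_def :: "complex^2^2 \<Rightarrow> bool" where
  "pos_def A \<longleftrightarrow> (\<exists>t x y z. A = herm t x y z \<and> t > 0 \<and> t\<^sup>2 > x\<^sup>2 + y\<^sup>2 + z\<^sup>2)"

lemma pos_def_iff: "pos_def A \<longleftrightarrow> dag A = A \<and> Re (trace A) > 0 \<and> Re (det A) > 0"
proof
  assume "pos_def A" thus "dag A = A \<and> Re (trace A) > 0 \<and> Re (det A) > 0"
    unfolding pos_def_def by (auto simp: det_herm trace_herm)
next
  assume a: "dag A = A \<and> Re (trace A) > 0 \<and> Re (det A) > 0"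
  then obtain t x y z where "A = herm t x y z" using herm_cases by metis
  with a show "pos_def A" by (auto simp: pos_def_def det_herm trace_herm herm_eq_iff)
qed

lemma pos_def_add: assumes "pos_def A" "pos_def B" shows "pos_def (A + B)"
proof -
  obtain t x y z where A: "A = herm t x y z" "t > 0" "t\<^sup>2 > x\<^sup>2 + y\<^sup>2 + z\<^sup>2" using assms pos_def_def by auto
  obtain t' x' y' z' where B: "B = herm t' x' y' z'" "t' > 0" "t'\<^sup>2 > x'\<^sup>2 + y'\<^sup>2 + z'\<^sup>2" using assms pos_def_def by auto
  define v w where "v = (x, y, z)" and "w = (x', y', z')"
  have n: "norm v < t" "norm w < t'"
    using A(2,3) B(2,3) by (auto simp: v_def w_def norm_prod_def add.assoc intro!: real_less_lsqrt)
  have "norm (v + w) < t + t'" using n norm_triangle_ineq[of v w] by linarith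
  hence "(norm (v + w))\<^sup>2 < (t + t')\<^sup>2" by (simp add: power_strict_mono)
  moreover have "(norm (v + w))\<^sup>2 = (x + x')\<^sup>2 + (y + y')\<^sup>2 + (z + z')\<^sup>2"
    by (simp add: v_def w_def norm_prod_def)
  ultimately have "(x + x')\<^sup>2 + (y + y')\<^sup>2 + (z + z')\<^sup>2 < (t + t')\<^sup>2" by simp
  thus ?thesis using A B by (auto simp: pos_def_def herm_add herm_eq_iff)
qed

lemma pos_def_scale: assumes "pos_def A" "c > 0" shows "pos_def (c *\<^sub>R A)"
proof -
  obtain t x y z where A: "A = herm t x y z" "t > 0" "t\<^sup>2 > x\<^sup>2 + y\<^sup>2 + z\<^sup>2" using assms pos_def_def by auto
  have "c\<^sup>2 * (x\<^sup>2 + y\<^sup>2 + z\<^sup>2) < c\<^sup>2 * t\<^sup>2" using A(3) assms(2) by simp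
  thus ?thesis using A assms(2) by (auto simp: pos_def_def herm_scale herm_eq_iff power_mult_distrib distrib_left)
qed

lemma pos_def_square: assumes "det R \<noteq> 0" shows "pos_def (R ** dag R)"
proof -
  have "Re (trace (R ** dag R)) = (cmod (R$1$1))\<^sup>2 + (cmod (R$1$2))\<^sup>2 + (cmod (R$2$1))\<^sup>2 + (cmod (R$2$2))\<^sup>2"
    unfolding cmod_sq by (simp add: trace2 mat2_mult_nth power2_eq_square)
  moreover have "(cmod (R$1$1))\<^sup>2 + (cmod (R$1$2))\<^sup>2 + (cmod (R$2$1))\<^sup>2 + (cmod (R$2$2))\<^sup>2 \<noteq> 0"
    using assms by (auto simp: det_2 add_nonneg_eq_0_iff)
  moreover have "(cmod (R$1$1))\<^sup>2 + (cmod (R$1$2))\<^sup>2 + (cmod (R$2$1))\<^sup>2 + (cmod (R$2$2))\<^sup>2 \<ge> 0" by simp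
  ultimately have "Re (trace (R ** dag R)) > 0" by linarith
  moreover have "Re (det (R ** dag R)) > 0"
    using Re_det_conj[of R "mat 1"] assms by simp
  ultimately show ?thesis by (simp add: pos_def_iff dag_mult)
qed

lemma pos_def_cholesky: assumes "pos_def P" obtains B where "det B \<noteq> 0" "B ** dag B = P"
proof -
  obtain t x y z where P: "P = herm t x y z" "t > 0" "t\<^sup>2 > x\<^sup>2 + y\<^sup>2 + z\<^sup>2" using assms pos_def_def by auto
  have "z\<^sup>2 < t\<^sup>2" using P(3) by (smt (verit) zero_le_power2)
  hence "\<bar>z\<bar> < t" using P(2) by (simp add: power2_less_imp_less abs_le_square_iff)
  hence s: "t + z > 0" by linarith
  define r where "r = sqrt (t + z)"
  define d where "d = t\<^sup>2 - (x\<^sup>2 + y\<^sup>2 + z\<^sup>2)"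
  have d: "d > 0" using P by (simp add: d_def)
  have r: "r > 0" "r * r = t + z" using s by (simp_all add: r_def)
  define B :: "complex^2^2" where
    "B = vector [vector [of_real r, 0], vector [Complex (x/r) (y/r), of_real (sqrt d / r)]]"
  have Bn: "B$1$1 = of_real r" "B$1$2 = 0" "B$2$1 = Complex (x/r) (y/r)" "B$2$2 = of_real (sqrt d / r)"
    by (simp_all add: B_def)
  have e: "x / r * (x / r) + y / r * (y / r) + sqrt d / r * (sqrt d / r) = t - z"
  proof -
    have "x / r * (x / r) + y / r * (y / r) + sqrt d / r * (sqrt d / r) = (x * x + y * y + d) / (r * r)"
      using d by (simp add: add_divide_distrib)
    also have "x * x + y * y + d = (t - z) * (t + z)" by (simp add: d_def power2_eq_square algebra_simps)
    finally show ?thesis using s by (simp add: r)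
  qed
  have "B ** dag B = P" unfolding P(1) using e r
    by (simp add: mat2_eq_iff mat2_mult_nth Bn complex_eq_iff)
  moreover have "det B \<noteq> 0" using r d by (simp add: det_2 Bn)
  ultimately show ?thesis using that by blast
qed

lemma pos_def_conj: assumes "pos_def P" "det B \<noteq> 0" shows "pos_def (B ** P ** dag B)"
proof -
  obtain Q where Q: "det Q \<noteq> 0" "Q ** dag Q = P" using pos_def_cholesky assms(1) by blast
  have "B ** P ** dag B = (B ** Q) ** dag (B ** Q)" unfolding Q(2)[symmetric]
    by (simp add: dag_mult matrix_mul_assoc)
  thus ?thesis using pos_def_square[of "B ** Q"] Q assms by (simp add: det_mul)
qed

text \<open>For pure states, on the Bloch sphere, the hypothesis makes the image positive definite;
  any point inside the sphere is a mixture of two antipodal pure states.\<close>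

lemma pos_def_chan:
  assumes nd: "\<And>p q. (cmod p)\<^sup>2 + (cmod q)\<^sup>2 = 1 \<Longrightarrow> gdet (map (app p q) Xs) > 0"
    and "x\<^sup>2 + y\<^sup>2 + z\<^sup>2 \<le> (1::real)"
  shows "pos_def (chan Xs (herm 1 x y z))"
proof -
  have b: "pos_def (chan Xs (herm 1 x y z))" if u: "x\<^sup>2 + y\<^sup>2 + z\<^sup>2 = (1::real)" for x y z
  proof -
    obtain p q where pq: "(cmod p)\<^sup>2 + (cmod q)\<^sup>2 = 1" "herm 1 x y z = 2 *\<^sub>R outer p q"
      using rank_one_herm[OF u] by blast
    let ?vs = "map (app p q) Xs"
    have g: "gdet ?vs > 0" by (rule nd[OF pq(1)])
    have "dag (gmat ?vs) = gmat ?vs" by (simp add: mat2_eq_iff gmat_nth)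
    moreover have "Re (det (gmat ?vs)) > 0" using g by (simp add: det_gmat)
    moreover have "Re (trace (gmat ?vs)) > 0"
    proof -
      have n: "(\<Sum>(a, b)\<leftarrow>?vs. (cmod a)\<^sup>2) \<ge> 0" "(\<Sum>(a, b)\<leftarrow>?vs. (cmod b)\<^sup>2) \<ge> 0"
        by (auto intro!: sum_list_nonneg split: prod.splits)
      have "(\<Sum>(a, b)\<leftarrow>?vs. (cmod a)\<^sup>2) \<noteq> 0"
      proof
        assume "(\<Sum>(a, b)\<leftarrow>?vs. (cmod a)\<^sup>2) = 0"
        hence "gdet ?vs \<le> 0" unfolding gdet_def by (simp only: mult_zero_left) simp
        thus False using g by simp
      qed
      thus ?thesis using n by (simp add: trace2 gmat_nth)
    qed
    ultimately have "pos_def (gmat ?vs)" by (simp add: pos_def_iff)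
    thus ?thesis unfolding pq(2) chan_scale chan_outer by (rule pos_def_scale) simp
  qed
  define r where "r = sqrt (x\<^sup>2 + y\<^sup>2 + z\<^sup>2)"
  have r: "0 \<le> r" "r \<le> 1" "r\<^sup>2 = x\<^sup>2 + y\<^sup>2 + z\<^sup>2" using assms(2) by (simp_all add: r_def)
  show ?thesis
  proof (cases "r = 1")
    case True thus ?thesis using b r by simp
  next
    case False
    obtain a c d where u: "a\<^sup>2 + c\<^sup>2 + d\<^sup>2 = 1" "x = r * a" "y = r * c" "z = r * d"
    proof (cases "r = 0")
      case True
      hence "x = 0" "y = 0" "z = 0" using r(3) by (simp_all add: add_nonneg_eq_0_iff)
      thus ?thesis using that[of 1 0 0] True by simp
    next
      case False
      have "(x/r)\<^sup>2 + (y/r)\<^sup>2 + (z/r)\<^sup>2 = (x\<^sup>2 + y\<^sup>2 + z\<^sup>2) / r\<^sup>2"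
        by (simp add: power_divide add_divide_distrib)
      also have "\<dots> = 1" using False by (simp add: r(3)[symmetric])
      finally have "(x/r)\<^sup>2 + (y/r)\<^sup>2 + (z/r)\<^sup>2 = 1" .
      thus ?thesis using that[of "x/r" "y/r" "z/r"] False by simp
    qed
    have "herm 1 x y z = ((1 + r) / 2) *\<^sub>R herm 1 a c d + ((1 - r) / 2) *\<^sub>R herm 1 (-a) (-c) (-d)"
      unfolding herm_scale herm_add herm_eq_iff u by (simp add: field_simps)
    moreover have "pos_def (chan Xs (herm 1 a c d))" "pos_def (chan Xs (herm 1 (-a) (-c) (-d)))"
      using b[of a c d] b[of "-a" "-c" "-d"] u by simp_all
    ultimately show ?thesis using False r by (simp add: chan_add chan_scale pos_def_add pos_def_scale)
  qed
qed

text \<open>\<open>chan Xs\<close> is real linear in Pauli coordinates, so the determinant is a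
  polynomial in v.\<close>

lemma continuous_on_det_chan:
  "continuous_on S (\<lambda>v::real^3. Re (det (chan Xs (herm 1 (v$1) (v$2) (v$3)))))"
proof -
  have h: "\<exists>t x y z. chan Xs (herm t0 x0 y0 z0) = herm t x y z" for t0 x0 y0 z0
    by (metis dag_chan dag_herm herm_cases)
  obtain a0 b0 c0 d0 where 0: "chan Xs (herm 1 0 0 0) = herm a0 b0 c0 d0" using h by blast
  obtain a1 b1 c1 d1 where 1: "chan Xs (herm 0 1 0 0) = herm a1 b1 c1 d1" using h by blast
  obtain a2 b2 c2 d2 where 2: "chan Xs (herm 0 0 1 0) = herm a2 b2 c2 d2" using h by blast
  obtain a3 b3 c3 d3 where 3: "chan Xs (herm 0 0 0 1) = herm a3 b3 c3 d3" using h by blast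
  have e: "chan Xs (herm t x y z) = herm (a0 * t + a1 * x + a2 * y + a3 * z) (b0 * t + b1 * x + b2 * y + b3 * z)
     (c0 * t + c1 * x + c2 * y + c3 * z) (d0 * t + d1 * x + d2 * y + d3 * z)" for t x y z
  proof -
    have "herm t x y z = t *\<^sub>R herm 1 0 0 0 + x *\<^sub>R herm 0 1 0 0 + y *\<^sub>R herm 0 0 1 0 + z *\<^sub>R herm 0 0 0 1"
      by (simp add: herm_scale herm_add)
    hence "chan Xs (herm t x y z) = t *\<^sub>R herm a0 b0 c0 d0 + x *\<^sub>R herm a1 b1 c1 d1 + y *\<^sub>R herm a2 b2 c2 d2 + z *\<^sub>R herm a3 b3 c3 d3"
      by (simp only: chan_add chan_scale 0 1 2 3)
    thus ?thesis by (simp add: herm_scale herm_add mult.commute)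
  qed
  show ?thesis unfolding e det_herm Re_complex_of_real by (intro continuous_intros)
qed

text \<open>Minimising \<open>det (chan Xs P) / det P\<close> over positive definite \<open>P\<close> and moving the minimiser and
  its image to the identity makes the map unital and trace preserving; the nondegeneracy
  hypothesis keeps the minimiser away from the boundary.\<close>

lemma doubly_stochastic_frame:
  assumes nd: "\<And>p q. (cmod p)\<^sup>2 + (cmod q)\<^sup>2 = 1 \<Longrightarrow> gdet (map (app p q) Xs) > 0"
  obtains A B where "det A \<noteq> 0" "det B \<noteq> 0"
    "chan (map (\<lambda>X. A ** X ** B) Xs) (mat 1) = mat 1"
    "\<And>x y z. trace (chan (map (\<lambda>X. A ** X ** B) Xs) (herm 0 x y z)) = 0"
proof -
  define F where "F v = Re (det (chan Xs (herm 1 (v$1) (v$2) (v$3))))" for v :: "real^3"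
  have vv: "v \<bullet> v = (v$1)\<^sup>2 + (v$2)\<^sup>2 + (v$3)\<^sup>2" for v :: "real^3"
    by (simp add: inner_vec_def sum_3 power2_eq_square)
  have pdc: "pos_def (chan Xs (herm 1 (v$1) (v$2) (v$3)))" if "v \<bullet> v \<le> 1" for v :: "real^3"
    by (rule pos_def_chan[OF nd]) (use that vv in auto)
  have Fpos: "F v > 0" if "v \<bullet> v \<le> 1" for v using pdc[OF that] by (simp add: F_def pos_def_iff)
  have cball: "v \<in> cball 0 1 \<longleftrightarrow> v \<bullet> v \<le> 1" for v :: "real^3"
    by (simp add: power2_norm_eq_inner[symmetric] abs_square_le_1)
  \<comment> \<open>The reciprocal ratio is maximised: it is continuous on the closed ball, zero on
    the sphere and positive at the centre, so the maximum is attained inside.\<close>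
  have "continuous_on (cball 0 1) (\<lambda>v. (1 - v \<bullet> v) / F v)"
  proof (intro continuous_intros ballI)
    show "continuous_on (cball 0 1) F" unfolding F_def by (rule continuous_on_det_chan)
    fix v assume "v \<in> cball (0::real^3) 1"
    thus "F v \<noteq> 0" using Fpos[of v] cball[of v] by simp
  qed
  then obtain m where m: "m \<bullet> m \<le> 1" "\<And>v. v \<bullet> v \<le> 1 \<Longrightarrow> (1 - v \<bullet> v) / F v \<le> (1 - m \<bullet> m) / F m"
    using continuous_attains_sup[of "cball (0::real^3) 1" "\<lambda>v. (1 - v \<bullet> v) / F v"] cball by auto
  have "0 < (1 - (0::real^3) \<bullet> 0) / F 0" using Fpos[of 0] by simp
  also have "\<dots> \<le> (1 - m \<bullet> m) / F m" by (rule m(2)) simp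
  finally have m1: "m \<bullet> m < 1" using Fpos[OF m(1)] by (simp add: zero_less_divide_iff)
  define M where "M = herm 1 (m$1) (m$2) (m$3)"
  have dM: "Re (det M) = 1 - m \<bullet> m" by (simp add: M_def det_herm vv)
  have pdM: "pos_def M" using m1 by (auto simp: M_def pos_def_def herm_eq_iff vv)
  have pdE: "pos_def (chan Xs M)" unfolding M_def by (rule pdc[OF m(1)])
  \<comment> \<open>Both determinants are homogeneous of degree two, so optimality on the slice t =
    1 extends to the whole cone.\<close>
  have min: "Re (det (chan Xs P)) * Re (det M) \<ge> Re (det (chan Xs M)) * Re (det P)" if "pos_def P" for P
  proof -
    obtain t x y z where P: "P = herm t x y z" "t > 0" "t\<^sup>2 > x\<^sup>2 + y\<^sup>2 + z\<^sup>2" using \<open>pos_def P\<close> pos_def_def by auto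
    define v :: "real^3" where "v = vector [x/t, y/t, z/t]"
    have v: "v$1 = x/t" "v$2 = y/t" "v$3 = z/t" by (simp_all add: v_def)
    have v2: "v \<bullet> v = (x\<^sup>2 + y\<^sup>2 + z\<^sup>2) / t\<^sup>2" by (simp add: vv v power_divide add_divide_distrib)
    have v1: "v \<bullet> v \<le> 1" using P by (simp add: v2)
    have Pt: "P = t *\<^sub>R herm 1 (v$1) (v$2) (v$3)" using P by (simp add: herm_scale v)
    have dt: "det (t *\<^sub>R Q) = of_real (t\<^sup>2) * det Q" for Q :: "complex^2^2"
      by (simp add: det_2 scaleR_conv_of_real[where 'a=complex] power2_eq_square algebra_simps)
    have f1: "Re (det (chan Xs P)) = t\<^sup>2 * F v" unfolding Pt chan_scale dt F_def by (simp del: of_real_power)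
    have f2: "Re (det P) = t\<^sup>2 * (1 - v \<bullet> v)" unfolding Pt dt det_herm by (simp add: vv del: of_real_power)
    have "(1 - v \<bullet> v) * F m \<le> (1 - m \<bullet> m) * F v"
      using m(2)[OF v1] Fpos[OF v1] Fpos[OF m(1)] by (simp add: divide_le_eq field_simps)
    hence f3: "t\<^sup>2 * ((1 - v \<bullet> v) * F m) \<le> t\<^sup>2 * ((1 - m \<bullet> m) * F v)" by (rule mult_left_mono) simp
    have f4: "Re (det (chan Xs M)) = F m" by (simp add: F_def M_def)
    show ?thesis using f3 unfolding f1 f2 f4 dM by (simp only: mult_ac)
  qed
  obtain B where B: "det B \<noteq> 0" "B ** dag B = M" using pos_def_cholesky[OF pdM] by blast
  obtain C where C: "det C \<noteq> 0" "C ** dag C = chan Xs M" using pos_def_cholesky[OF pdE] by blast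
  obtain A where A: "A ** C = mat 1" using C(1) invertible_det_nz[of C] unfolding invertible_def by blast
  have "det (A ** C) = 1" unfolding A by simp
  hence dA: "det A \<noteq> 0" by (auto simp: det_mul)
  define Ys where "Ys = map (\<lambda>X. A ** X ** B) Xs"
  have "A ** (C ** dag C) ** dag A = (A ** C) ** dag (A ** C)" by (simp add: dag_mult matrix_mul_assoc)
  hence AM: "A ** chan Xs M ** dag A = mat 1" by (simp add: A C(2))
  hence one: "chan Ys (mat 1) = mat 1" unfolding Ys_def chan_map by (simp add: B(2))
  have nA: "(cmod (det A))\<^sup>2 * Re (det (chan Xs M)) = 1" unfolding Re_det_conj[symmetric] AM by simp
  have nB: "(cmod (det B))\<^sup>2 = Re (det M)" using Re_det_conj[of B "mat 1"] B(2) by simp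
  \<comment> \<open>In the new frame the determinant never decreases, and it is preserved at the
    identity; the first-order condition there kills the trace of the image of a traceless
    matrix.\<close>
  have dec: "Re (det P) \<le> Re (det (chan Ys P))" if "pos_def P" for P
  proof -
    have q: "pos_def (B ** P ** dag B)" using that B(1) by (rule pos_def_conj)
    have "Re (det (chan Xs M)) * (Re (det M) * Re (det P)) \<le> Re (det (chan Xs (B ** P ** dag B))) * Re (det M)"
      using min[OF q] by (simp add: Re_det_conj nB)
    hence "Re (det M) * (Re (det (chan Xs M)) * Re (det P)) \<le> Re (det M) * Re (det (chan Xs (B ** P ** dag B)))"
      by (simp add: mult_ac)
    hence "Re (det (chan Xs M)) * Re (det P) \<le> Re (det (chan Xs (B ** P ** dag B)))"
      using m1 by (simp add: dM)
    hence "(cmod (det A))\<^sup>2 * (Re (det (chan Xs M)) * Re (det P)) \<le> (cmod (det A))\<^sup>2 * Re (det (chan Xs (B ** P ** dag B)))"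
      by (rule mult_left_mono) simp
    thus ?thesis unfolding Ys_def chan_map Re_det_conj mult.assoc[symmetric] nA by simp
  qed
  have tr: "trace (chan Ys (herm 0 x y z)) = 0" for x y z
  proof -
    obtain k0 k1 k2 k3 where K: "chan Ys (herm 0 x y z) = herm k0 k1 k2 k3"
      by (metis dag_chan dag_herm herm_cases)
    define s where "s = x\<^sup>2 + y\<^sup>2 + z\<^sup>2"
    have s0: "s \<ge> 0" by (simp add: s_def)
    \<comment> \<open>The radius 1 / (1 + s) keeps the perturbed identity positive definite.\<close>
    have "2 * k0 * t + (k0\<^sup>2 - (k1\<^sup>2 + k2\<^sup>2 + k3\<^sup>2) + s) * t\<^sup>2 \<ge> 0" if t: "\<bar>t\<bar> < 1 / (1 + s)" for t
    proof -
      have t1: "\<bar>t\<bar> * (1 + s) < 1" using t s0 by (simp add: pos_less_divide_eq)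
      have "\<bar>t\<bar> \<le> \<bar>t\<bar> * (1 + s)" using s0 by (simp add: mult_le_cancel_left1)
      hence "\<bar>t\<bar> < 1" using t1 by linarith
      hence "\<bar>t\<bar> * (\<bar>t\<bar> * s) \<le> 1 * (\<bar>t\<bar> * s)" using s0 by (intro mult_right_mono) auto
      also have "\<bar>t\<bar> * s < 1" using t1 by (simp add: distrib_left)
      finally have ts: "t\<^sup>2 * s < 1" by (simp add: power2_eq_square)
      have e: "herm 1 (t*x) (t*y) (t*z) = mat 1 + t *\<^sub>R herm 0 x y z"
        by (simp add: mat1_herm herm_scale herm_add)
      have "chan Ys (herm 1 (t*x) (t*y) (t*z)) = herm (1 + t*k0) (t*k1) (t*k2) (t*k3)"
        unfolding e chan_add chan_scale one K by (simp add: mat1_herm herm_scale herm_add)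
      moreover have "pos_def (herm 1 (t*x) (t*y) (t*z))"
        using ts by (auto simp: pos_def_def herm_eq_iff s_def power_mult_distrib distrib_left)
      ultimately have "1 - ((t*x)\<^sup>2 + (t*y)\<^sup>2 + (t*z)\<^sup>2) \<le> (1 + t*k0)\<^sup>2 - ((t*k1)\<^sup>2 + (t*k2)\<^sup>2 + (t*k3)\<^sup>2)"
        using dec[of "herm 1 (t*x) (t*y) (t*z)"] by (simp add: det_herm)
      thus ?thesis by (simp add: s_def power2_eq_square algebra_simps)
    qed
    hence "2 * k0 = 0" by (rule linear_coeff_zero[of "1 / (1 + s)", rotated]) (use s0 in simp_all)
    thus ?thesis by (simp add: K trace_herm)
  qed
  show ?thesis using that[OF dA B(1)] one tr unfolding Ys_def by blast
qed

section \<open>The magic basis\<close>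

text \<open>Coordinates with respect to the basis \<open>1, i\<sigma>\<^sub>1, i\<sigma>\<^sub>2, i\<sigma>\<^sub>3\<close> of the quaternions (Wootters' magic
  basis), in which the determinant is the sum of squares.\<close>

definition qmat :: "complex^4 \<Rightarrow> complex^2^2" where
  "qmat x = vector [vector [x$1 + \<i> * x$4, \<i> * x$2 + x$3], vector [\<i> * x$2 - x$3, x$1 - \<i> * x$4]]"

definition qcoord :: "complex^2^2 \<Rightarrow> complex^4" where
  "qcoord X = vector [(X$1$1 + X$2$2) / 2, - \<i> * (X$1$2 + X$2$1) / 2, (X$1$2 - X$2$1) / 2, - \<i> * (X$1$1 - X$2$2) / 2]"

lemma qmat_nth [simp]: "qmat x $ 1 $ 1 = x$1 + \<i> * x$4" "qmat x $ 1 $ 2 = \<i> * x$2 + x$3"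
   "qmat x $ 2 $ 1 = \<i> * x$2 - x$3" "qmat x $ 2 $ 2 = x$1 - \<i> * x$4"
  by (simp_all add: qmat_def)

lemma vector_4 [simp]:
  "(vector [a, b, c, d] :: 'a::zero^4) $ 1 = a" "(vector [a, b, c, d] :: 'a^4) $ 2 = b"
  "(vector [a, b, c, d] :: 'a^4) $ 3 = c" "(vector [a, b, c, d] :: 'a^4) $ 4 = d"
  by (simp_all add: vector_def)

lemma qcoord_nth [simp]: "qcoord X $ 1 = (X$1$1 + X$2$2) / 2" "qcoord X $ 2 = - \<i> * (X$1$2 + X$2$1) / 2"
   "qcoord X $ 3 = (X$1$2 - X$2$1) / 2" "qcoord X $ 4 = - \<i> * (X$1$1 - X$2$2) / 2"
  by (simp_all add: qcoord_def)

lemma qmat_qcoord [simp]: "qmat (qcoord X) = X"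
  by (simp add: mat2_eq_iff field_simps)

lemma qcoord_qmat [simp]: "qcoord (qmat x) = x"
  by (simp add: vec_eq_iff forall_4 field_simps)

lemma det_qmat: "det (qmat x) = (\<Sum>i\<in>UNIV. (x$i)\<^sup>2)"
  by (simp add: det_2 sum_4 power2_eq_square algebra_simps)

lemma same_ens_qcoord:
  assumes "\<And>a b. (\<Sum>X\<leftarrow>Xs. qcoord X $ a * cnj (qcoord X $ b)) = (\<Sum>Y\<leftarrow>Ys. qcoord Y $ a * cnj (qcoord Y $ b))"
  shows "same_ens Xs Ys"
proof -
  define c where "c i j a = qmat (axis a 1) $ i $ j" for i j :: 2 and a :: 4
  have e: "X $ i $ j = (\<Sum>a\<in>UNIV. c i j a * qcoord X $ a)" for X :: "complex^2^2" and i j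
  proof -
    have "qmat x $ i $ j = (\<Sum>a\<in>UNIV. c i j a * x $ a)" for x
      using exhaust_2[of i] exhaust_2[of j] by (auto simp: c_def sum_4 axis_def)
    from this[of "qcoord X"] show ?thesis by simp
  qed
  show ?thesis unfolding same_ens_def
    by (subst (1 2 3 4) e) (simp only: sum_list_expand_prod[where f="\<lambda>X a. qcoord X $ a" and g="\<lambda>X a. qcoord X $ a"] assms simp_thms)
qed

lemma Im_sum_list: "Im (\<Sum>x\<leftarrow>xs. f x) = (\<Sum>x\<leftarrow>xs. Im (f x))"
  by (induction xs) simp_all

lemma Re_sum_list: "Re (\<Sum>x\<leftarrow>xs. f x) = (\<Sum>x\<leftarrow>xs. Re (f x))"
  by (induction xs) simp_all

lemma chan_nth: "chan Xs P $ i $ j = (\<Sum>X\<leftarrow>Xs. (X ** P ** dag X) $ i $ j)"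
  by (induction Xs) simp_all

lemma trace_chan: "trace (chan Xs P) = (\<Sum>X\<leftarrow>Xs. trace (X ** P ** dag X))"
  by (induction Xs) (simp_all add: trace2)

text \<open>Each off-diagonal imaginary part is a fixed combination of the trace of L on a traceless
  matrix and the traceless Pauli components of L(1). All of these vanish by hypothesis.\<close>

lemma doubly_stochastic_real:
  assumes one: "chan Ys (mat 1) = mat 1" and tr: "\<And>x y z. trace (chan Ys (herm 0 x y z)) = 0"
  shows "(\<Sum>Y\<leftarrow>Ys. Im (qcoord Y $ a * cnj (qcoord Y $ b))) = 0"
proof -
  have s: "(\<Sum>Y\<leftarrow>Ys. Re ((Y ** dag Y) $ 2 $ 1)) = 0" "(\<Sum>Y\<leftarrow>Ys. Im ((Y ** dag Y) $ 2 $ 1)) = 0"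
    "(\<Sum>Y\<leftarrow>Ys. Re ((Y ** dag Y) $ 1 $ 1)) = 1" "(\<Sum>Y\<leftarrow>Ys. Re ((Y ** dag Y) $ 2 $ 2)) = 1"
    using chan_nth[of Ys "mat 1", symmetric] unfolding one matrix_mul_rid Re_sum_list[symmetric] Im_sum_list[symmetric]
    by (simp_all only: mat1_herm herm_nth) simp_all
  have t: "(\<Sum>Y\<leftarrow>Ys. Re (trace (Y ** herm 0 x y z ** dag Y))) = 0" for x y z
    using tr[of x y z] unfolding trace_chan Re_sum_list[symmetric] by simp
  \<comment> \<open>The premise is the pointwise identity to be certified; six pairs of indices
    supply its coefficients below, and antisymmetry covers the remaining ones.\<close>
  have l: "(\<Sum>Y\<leftarrow>Ys. Im (qcoord Y $ i * cnj (qcoord Y $ j))) = 0"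
    if "\<And>Y. 4 * Im (qcoord Y $ i * cnj (qcoord Y $ j)) =
       Re (trace (Y ** herm 0 x y z ** dag Y)) / 2 + a * Re ((Y ** dag Y) $ 2 $ 1) + b * Im ((Y ** dag Y) $ 2 $ 1)
       + c * Re ((Y ** dag Y) $ 1 $ 1) - c * Re ((Y ** dag Y) $ 2 $ 2)" for i j x y z a b c
  proof -
    have "(\<Sum>Y\<leftarrow>Ys. 4 * Im (qcoord Y $ i * cnj (qcoord Y $ j))) =
       (\<Sum>Y\<leftarrow>Ys. Re (trace (Y ** herm 0 x y z ** dag Y))) / 2 + a * (\<Sum>Y\<leftarrow>Ys. Re ((Y ** dag Y) $ 2 $ 1))
       + b * (\<Sum>Y\<leftarrow>Ys. Im ((Y ** dag Y) $ 2 $ 1)) + c * (\<Sum>Y\<leftarrow>Ys. Re ((Y ** dag Y) $ 1 $ 1))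
       - c * (\<Sum>Y\<leftarrow>Ys. Re ((Y ** dag Y) $ 2 $ 2))"
      unfolding that by (induction Ys) (simp_all add: algebra_simps add_divide_distrib)
    thus ?thesis unfolding s t sum_list_const_mult by simp
  qed
  note q = mat2_mult_nth trace2
  have p12: "(\<Sum>Y\<leftarrow>Ys. Im (qcoord Y $ 1 * cnj (qcoord Y $ 2))) = 0"
    by (rule l[of 1 2 1 0 0 1 0 0]) (simp add: q field_simps)
  have p13: "(\<Sum>Y\<leftarrow>Ys. Im (qcoord Y $ 1 * cnj (qcoord Y $ 3))) = 0"
    by (rule l[of 1 3 0 1 0 0 1 0]) (simp add: q field_simps)
  have p14: "(\<Sum>Y\<leftarrow>Ys. Im (qcoord Y $ 1 * cnj (qcoord Y $ 4))) = 0"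
    by (rule l[of 1 4 0 0 1 0 0 "1/2"]) (simp add: q field_simps)
  have p34: "(\<Sum>Y\<leftarrow>Ys. Im (qcoord Y $ 3 * cnj (qcoord Y $ 4))) = 0"
    by (rule l[of 3 4 1 0 0 "-1" 0 0]) (simp add: q field_simps)
  have p42: "(\<Sum>Y\<leftarrow>Ys. Im (qcoord Y $ 4 * cnj (qcoord Y $ 2))) = 0"
    by (rule l[of 4 2 0 1 0 0 "-1" 0]) (simp add: q field_simps)
  have p23: "(\<Sum>Y\<leftarrow>Ys. Im (qcoord Y $ 2 * cnj (qcoord Y $ 3))) = 0"
    by (rule l[of 2 3 0 0 1 0 0 "-1/2"]) (simp add: q field_simps)
  have sw: "(\<Sum>Y\<leftarrow>Ys. Im (qcoord Y $ j * cnj (qcoord Y $ i))) = - (\<Sum>Y\<leftarrow>Ys. Im (qcoord Y $ i * cnj (qcoord Y $ j)))" for i j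
    by (induction Ys) (simp_all del: qcoord_nth add: algebra_simps)
  have d: "(\<Sum>Y\<leftarrow>Ys. Im (qcoord Y $ i * cnj (qcoord Y $ i))) = 0" for i
    using sw[of i i] by linarith
  show ?thesis using exhaust_4[of a] exhaust_4[of b] p12 p13 p14 p34 p42 p23 d
      sw[of 1 2] sw[of 1 3] sw[of 1 4] sw[of 3 4] sw[of 4 2] sw[of 2 3]
    by (elim disjE; simp only: neg_equal_0_iff_equal neg_0_equal_iff_equal; linarith)
qed

text \<open>The gap between the two sides is exactly |tr (u Z)|^2, where u =
  \<open>herm 0 x y z\<close>.\<close>

lemma trace_reflection:
  assumes "x\<^sup>2 + y\<^sup>2 + z\<^sup>2 = 1"
  shows "Re (trace (herm 0 x y z ** Z ** herm 0 x y z ** dag Z))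
    \<ge> (cmod (trace Z))\<^sup>2 - ((cmod (Z$1$1))\<^sup>2 + (cmod (Z$1$2))\<^sup>2 + (cmod (Z$2$1))\<^sup>2 + (cmod (Z$2$2))\<^sup>2)"
proof -
  have "Re (trace (herm 0 x y z ** Z ** herm 0 x y z ** dag Z))
    = (x\<^sup>2 + y\<^sup>2 + z\<^sup>2) * ((cmod (trace Z))\<^sup>2
        - ((cmod (Z$1$1))\<^sup>2 + (cmod (Z$1$2))\<^sup>2 + (cmod (Z$2$1))\<^sup>2 + (cmod (Z$2$2))\<^sup>2))
      + (cmod (trace (herm 0 x y z ** Z)))\<^sup>2"
    unfolding cmod_sq by (simp add: trace2 mat2_mult_nth power2_eq_square) algebra
  thus ?thesis using assms by simp
qed

text \<open>Half the trace of a product of traceless Hermitian matrices is the inner product of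
  their Bloch vectors.\<close>

lemma traceless_cauchy_schwarz:
  assumes "m1\<^sup>2 + m2\<^sup>2 + m3\<^sup>2 = 1"
  shows "(Re (trace (herm 0 m1 m2 m3 ** herm 0 x y z)) / 2)\<^sup>2 \<le> x\<^sup>2 + y\<^sup>2 + z\<^sup>2"
proof -
  have "Re (trace (herm 0 m1 m2 m3 ** herm 0 x y z)) / 2 = (m1, m2, m3) \<bullet> (x, y, z)"
    by (simp add: trace2 mat2_mult_nth inner_prod_def)
  hence "(Re (trace (herm 0 m1 m2 m3 ** herm 0 x y z)) / 2)\<^sup>2
      \<le> ((m1, m2, m3) \<bullet> (m1, m2, m3)) * ((x, y, z) \<bullet> (x, y, z))"
    by (simp only: Cauchy_Schwarz_ineq)
  also have "\<dots> = (m1\<^sup>2 + m2\<^sup>2 + m3\<^sup>2) * (x\<^sup>2 + y\<^sup>2 + z\<^sup>2)"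
    by (simp add: inner_prod_def power2_eq_square add.assoc)
  finally show ?thesis using assms by simp
qed

text \<open>In magic coordinates the state is real of trace one, so Wootters' decomposition costs at
  most max 0 (2 l - 1), with l the value of the form at a unit vector \<open>e\<close>. The unitary
  with coordinates \<open>e\<close> certifies that, for every unit direction u, the Bloch length of
  L(u) is at least 2 l - 1; as L(u) is traceless, - det L(u) is the square of that length.\<close>

lemma bell_ensemble:
  assumes one: "chan Ys (mat 1) = mat 1" and tr: "\<And>x y z. trace (chan Ys (herm 0 x y z)) = 0"
  obtains Zs where "same_ens Ys Zs"
    and "\<And>x y z. x\<^sup>2 + y\<^sup>2 + z\<^sup>2 = 1 \<Longrightarrow>
      (\<Sum>Z\<leftarrow>Zs. cmod (det Z))\<^sup>2 \<le> - Re (det (chan Ys (herm 0 x y z)))"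
proof -
  define re im :: "complex^2^2 \<Rightarrow> real^4" where
    "re Y = (\<chi> i. Re (qcoord Y $ i))" and "im Y = (\<chi> i. Im (qcoord Y $ i))" for Y
  define vs where "vs = map re Ys @ map im Ys"
  obtain ps e where e: "norm e = 1" and P: "\<forall>x y. pform ps x y = qform vs x y" "\<forall>x y. pskew ps x y = 0"
    and C: "pcost ps \<le> max 0 (2 * qform vs e e - (\<Sum>v\<leftarrow>vs. v \<bullet> v))"
    using real_form_ensemble[of vs] by (elim exE conjE)
  define cv :: "(real^4) \<times> (real^4) \<Rightarrow> complex^4" where "cv p = (\<chi> i. Complex (fst p $ i) (snd p $ i))" for p
  define Zs where "Zs = map (\<lambda>p. qmat (cv p)) ps"
  have ax: "v \<bullet> axis i 1 = v $ i" for v :: "real^4" and i by (simp add: inner_axis)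
  have "same_ens Ys Zs"
  proof (rule same_ens_qcoord)
    fix a b
    have Zr: "Re (\<Sum>Z\<leftarrow>Zs. qcoord Z $ a * cnj (qcoord Z $ b)) = pform ps (axis a 1) (axis b 1)"
      unfolding Zs_def by (induction ps) (auto simp: cv_def ax simp del: qcoord_nth)
    have Zi: "Im (\<Sum>Z\<leftarrow>Zs. qcoord Z $ a * cnj (qcoord Z $ b)) = pskew ps (axis a 1) (axis b 1)"
      unfolding Zs_def by (induction ps) (auto simp: cv_def ax simp del: qcoord_nth)
    have Yr: "Re (\<Sum>Y\<leftarrow>Ys. qcoord Y $ a * cnj (qcoord Y $ b)) = qform vs (axis a 1) (axis b 1)"
      unfolding vs_def by (induction Ys) (auto simp: re_def im_def ax simp del: qcoord_nth)
    have "Im (\<Sum>Y\<leftarrow>Ys. qcoord Y $ a * cnj (qcoord Y $ b)) = 0"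
      unfolding Im_sum_list by (rule doubly_stochastic_real[OF one tr])
    thus "(\<Sum>X\<leftarrow>Ys. qcoord X $ a * cnj (qcoord X $ b)) = (\<Sum>Y\<leftarrow>Zs. qcoord Y $ a * cnj (qcoord Y $ b))"
      using Zr Zi Yr P by (simp only: complex_eq_iff)
  qed
  moreover have cost: "(\<Sum>Z\<leftarrow>Zs. cmod (det Z)) = pcost ps"
  proof -
    have "det (qmat (cv (a, b))) = Complex (a \<bullet> a - b \<bullet> b) (2 * (a \<bullet> b))" for a b
      unfolding det_qmat by (simp add: sum_4 inner_vec_def cv_def power2_eq_square complex_eq_iff)
    thus ?thesis unfolding Zs_def by (induction ps) auto
  qed
  have frob: "(\<Sum>Y\<leftarrow>Ys. (cmod (Y$1$1))\<^sup>2 + (cmod (Y$1$2))\<^sup>2 + (cmod (Y$2$1))\<^sup>2 + (cmod (Y$2$2))\<^sup>2) = 2"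
  proof -
    have "Re (trace (chan Ys (mat 1))) = (\<Sum>Y\<leftarrow>Ys. (cmod (Y$1$1))\<^sup>2 + (cmod (Y$1$2))\<^sup>2 + (cmod (Y$2$1))\<^sup>2 + (cmod (Y$2$2))\<^sup>2)"
      unfolding trace_chan Re_sum_list cmod_sq
      by (simp add: trace2 mat2_mult_nth power2_eq_square add.assoc)
    thus ?thesis unfolding one by (simp add: trace2 mat_def)
  qed
  have vsum: "(\<Sum>v\<leftarrow>vs. v \<bullet> v) = 1"
  proof -
    have "2 * (re Y \<bullet> re Y + im Y \<bullet> im Y) = (cmod (Y$1$1))\<^sup>2 + (cmod (Y$1$2))\<^sup>2 + (cmod (Y$2$1))\<^sup>2 + (cmod (Y$2$2))\<^sup>2" for Y
      unfolding cmod_sq by (simp add: re_def im_def inner_vec_def sum_4 power2_eq_square field_simps)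
    hence "2 * (\<Sum>v\<leftarrow>vs. v \<bullet> v) = (\<Sum>Y\<leftarrow>Ys. (cmod (Y$1$1))\<^sup>2 + (cmod (Y$1$2))\<^sup>2 + (cmod (Y$2$1))\<^sup>2 + (cmod (Y$2$2))\<^sup>2)"
      unfolding vs_def by (induction Ys) (auto simp: algebra_simps)
    thus ?thesis using frob by simp
  qed
  \<comment> \<open>A real unit vector of magic coordinates is a unit quaternion, hence a unitary
    matrix.\<close>
  define U where "U = qmat (\<chi> i. of_real (e $ i))"
  have ee: "e$1 * e$1 + e$2 * e$2 + e$3 * e$3 + e$4 * e$4 = 1"
    using e by (simp add: norm_eq_1 inner_vec_def sum_4)
  have U: "U ** dag U = mat 1" 
    using ee by (simp add: U_def mat2_eq_iff mat2_mult_nth mat_def complex_eq_iff algebra_simps)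
  have dU: "cmod (det U) = 1"
  proof -
    have "(cmod (det U))\<^sup>2 = 1" using Re_det_conj[of U "mat 1"] U by simp
    thus ?thesis by (simp add: power2_eq_1_iff) (metis norm_ge_zero not_one_le_zero neg_0_le_iff_le)
  qed
  have main: "(\<Sum>Z\<leftarrow>Zs. cmod (det Z))\<^sup>2 \<le> - Re (det (chan Ys (herm 0 x y z)))"
    if u: "x\<^sup>2 + y\<^sup>2 + z\<^sup>2 = 1" for x y z
  proof -
    define u where "u = herm 0 x y z"
    obtain k0 k1 k2 k3 where K: "chan Ys u = herm k0 k1 k2 k3"
      unfolding u_def by (metis dag_chan dag_herm herm_cases)
    have k0: "k0 = 0" using tr[of x y z] K by (simp add: u_def trace_herm)
    obtain m0 m1 m2 m3 where m: "U ** u ** dag U = herm m0 m1 m2 m3"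
      unfolding u_def by (metis dag_conj_self_adjoint dag_herm herm_cases)
    have U': "dag U ** U = mat 1" using U matrix_left_right_inverse by blast
    have "trace (U ** u ** dag U) = trace (dag U ** (U ** u))" by (rule trace_mul_sym)
    also have "dag U ** (U ** u) = u" by (simp add: matrix_mul_assoc U')
    finally have "trace (herm m0 m1 m2 m3) = trace u" unfolding m .
    hence m0: "m0 = 0" by (simp add: u_def trace_herm)
    have "Re (det (U ** u ** dag U)) = - 1"
      unfolding Re_det_conj dU by (simp add: u_def det_herm u)
    hence mm: "m1\<^sup>2 + m2\<^sup>2 + m3\<^sup>2 = 1" unfolding m det_herm m0 by simp
    \<comment> \<open>\<open>trace_reflection\<close> is applied to \<open>dag U ** Y\<close>, whose
      trace is twice the overlap of the coordinates of Y with \<open>e\<close>.\<close>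
    have pt: "Re (trace (U ** u ** dag U ** (Y ** u ** dag Y))) \<ge>
        4 * ((re Y \<bullet> e)\<^sup>2 + (im Y \<bullet> e)\<^sup>2) - ((cmod (Y$1$1))\<^sup>2 + (cmod (Y$1$2))\<^sup>2 + (cmod (Y$2$1))\<^sup>2 + (cmod (Y$2$2))\<^sup>2)" for Y
    proof -
      define Z where "Z = dag U ** Y"
      have "trace (U ** u ** dag U ** (Y ** u ** dag Y)) = trace (U ** (u ** dag U ** Y ** u ** dag Y))"
        by (simp add: matrix_mul_assoc)
      also have "\<dots> = trace (u ** dag U ** Y ** u ** dag Y ** U)" by (rule trace_mul_sym)
      also have "\<dots> = trace (u ** Z ** u ** dag Z)" by (simp add: Z_def dag_mult matrix_mul_assoc)
      finally have 1: "trace (U ** u ** dag U ** (Y ** u ** dag Y)) = trace (u ** Z ** u ** dag Z)" .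
      have fro: "Re (trace (W ** dag W)) = (cmod (W$1$1))\<^sup>2 + (cmod (W$1$2))\<^sup>2 + (cmod (W$2$1))\<^sup>2 + (cmod (W$2$2))\<^sup>2" for W
        unfolding cmod_sq by (simp add: trace2 mat2_mult_nth power2_eq_square)
      have "trace (Z ** dag Z) = trace (dag U ** (Y ** dag Y ** U))"
        by (simp add: Z_def dag_mult matrix_mul_assoc)
      also have "\<dots> = trace (Y ** dag Y ** U ** dag U)" by (rule trace_mul_sym)
      also have "\<dots> = trace (Y ** dag Y)" by (simp add: matrix_mul_assoc[symmetric] U)
      finally have 2: "trace (Z ** dag Z) = trace (Y ** dag Y)" .
      have "trace Z = 2 * Complex (re Y \<bullet> e) (im Y \<bullet> e)"
        by (simp add: Z_def U_def trace2 mat2_mult_nth re_def im_def inner_vec_def sum_4 complex_eq_iff field_simps)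
      hence 3: "(cmod (trace Z))\<^sup>2 = 4 * ((re Y \<bullet> e)\<^sup>2 + (im Y \<bullet> e)\<^sup>2)"
        unfolding cmod_sq by (simp add: power_mult_distrib)
      show ?thesis using trace_reflection[OF u, of Z] 2 unfolding 1 u_def[symmetric] 3 fro[symmetric] by simp
    qed
    have "2 * (2 * qform vs e e - 1) \<le> Re (trace (U ** u ** dag U ** chan Ys u))"
    proof -
      have t: "Re (trace (M ** chan Xs u)) = (\<Sum>Y\<leftarrow>Xs. Re (trace (M ** (Y ** u ** dag Y))))" for M Xs
      proof (induction Xs)
        case Nil show ?case by (simp add: trace2 mat2_mult_nth)
      next
        case (Cons X Xs) thus ?case by (simp add: mat2_add_mult trace_add)
      qed
      have "4 * qform vs e e - 2 = (\<Sum>Y\<leftarrow>Ys. 4 * ((re Y \<bullet> e)\<^sup>2 + (im Y \<bullet> e)\<^sup>2) - ((cmod (Y$1$1))\<^sup>2 + (cmod (Y$1$2))\<^sup>2 + (cmod (Y$2$1))\<^sup>2 + (cmod (Y$2$2))\<^sup>2))"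
      proof -
        have "qform vs e e = (\<Sum>Y\<leftarrow>Ys. (re Y \<bullet> e)\<^sup>2 + (im Y \<bullet> e)\<^sup>2)"
          unfolding vs_def by (induction Ys) (auto simp: power2_eq_square)
        thus ?thesis unfolding frob[symmetric] by (simp only: sum_list_const_mult sum_list_subtractf)
      qed
      also have "\<dots> \<le> (\<Sum>Y\<leftarrow>Ys. Re (trace (U ** u ** dag U ** (Y ** u ** dag Y))))"
        by (rule sum_list_mono) (rule pt)
      finally show ?thesis unfolding t by simp
    qed
    hence q: "2 * qform vs e e - 1 \<le> Re (trace (herm 0 m1 m2 m3 ** herm 0 k1 k2 k3)) / 2"
      by (simp add: m K m0 k0)
    have p0: "0 \<le> pcost ps" unfolding pcost_def by (rule sum_list_nonneg) auto
    have "(pcost ps)\<^sup>2 \<le> k1\<^sup>2 + k2\<^sup>2 + k3\<^sup>2"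
    proof (cases "pcost ps = 0")
      case False
      hence "pcost ps \<le> Re (trace (herm 0 m1 m2 m3 ** herm 0 k1 k2 k3)) / 2" using C p0 q vsum by linarith
      hence "(pcost ps)\<^sup>2 \<le> (Re (trace (herm 0 m1 m2 m3 ** herm 0 k1 k2 k3)) / 2)\<^sup>2"
        using p0 by (rule power_mono)
      also have "\<dots> \<le> k1\<^sup>2 + k2\<^sup>2 + k3\<^sup>2" by (rule traceless_cauchy_schwarz[OF mm])
      finally show ?thesis .
    qed simp
    thus ?thesis unfolding cost u_def[symmetric] K det_herm k0 by simp
  qed
  ultimately show ?thesis using that by blast
qed

section \<open>The trade-off for a single vector\<close>

lemma sum_list_cauchy_schwarz:
  fixes f g :: "'a \<Rightarrow> real"
  shows "(\<Sum>x\<leftarrow>xs. f x * g x)\<^sup>2 \<le> (\<Sum>x\<leftarrow>xs. (f x)\<^sup>2) * (\<Sum>x\<leftarrow>xs. (g x)\<^sup>2)"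
  unfolding sum_list_sum_nth
  using Cauchy_Schwarz_ineq_sum[of "\<lambda>i. f (xs ! i)" "\<lambda>i. g (xs ! i)" "{0..<length xs}"] by simp

text \<open>The columns (p, q) and (- conj q, conj p) form a unitary of determinant one.\<close>

lemma det_app:
  assumes "(cmod p)\<^sup>2 + (cmod q)\<^sup>2 = 1"
  shows "fst (app p q X) * snd (app (- cnj q) (cnj p) X) - snd (app p q X) * fst (app (- cnj q) (cnj p) X) = det X"
proof -
  have 1: "p * cnj p + q * cnj q = 1"
    unfolding mult_cnj_cmod of_real_add[symmetric] assms by simp
  have "fst (app p q X) * snd (app (- cnj q) (cnj p) X) - snd (app p q X) * fst (app (- cnj q) (cnj p) X)
      = (p * cnj p + q * cnj q) * det X"
    by (simp add: app_def det_2 algebra_simps)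
  thus ?thesis by (simp add: 1)
qed

text \<open>Concatenation contributes the cross minors between the two branches. The vectors X v are
  multiples of one vector, so det X factors as \<xi>(X) w(X), the cross minors sum to a product of
  two sums of squares, and Cauchy-Schwarz compares the two.\<close>

lemma single_vector_tradeoff_degenerate:
  assumes u: "(cmod p)\<^sup>2 + (cmod q)\<^sup>2 = 1" and z: "gdet (map (app p q) Xs) = 0"
  shows "(\<Sum>X\<leftarrow>Xs. cmod (det X))\<^sup>2 + gdet (map (app (- cnj q) (cnj p)) Xs)
    \<le> gdet (map (app p q) Xs @ map (app (- cnj q) (cnj p)) Xs)"
proof -
  let ?a = "app p q" and ?b = "app (- cnj q) (cnj p)"
  have "(\<Sum>X\<leftarrow>Xs. cmod (det X))\<^sup>2 \<le> (\<Sum>X\<leftarrow>Xs. wsum (?a X) (map ?b Xs))"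
  proof (cases "\<forall>X\<in>set Xs. ?a X = (0, 0)")
    case True
    have "cmod (det X) = 0" if "X \<in> set Xs" for X using True that unfolding det_app[OF u, symmetric] by simp
    hence m: "map (\<lambda>X. cmod (det X)) Xs = map (\<lambda>X. 0) Xs" by (intro map_cong) auto
    have "(\<Sum>X\<leftarrow>Xs. cmod (det X)) = 0" unfolding m by simp
    thus ?thesis by (auto intro!: sum_list_nonneg simp: wsum_nonneg)
  next
    case False
    then obtain X0 where X0: "X0 \<in> set Xs" "?a X0 \<noteq> (0, 0)" by blast
    obtain a b where ab: "?a X0 = (a, b)" by force
    have n0: "a \<noteq> 0 \<or> b \<noteq> 0" using X0 ab by auto
    \<comment> \<open>The multiple is read off at a nonzero coordinate of the reference
      vector.\<close>
    define \<xi> where "\<xi> X = (if a \<noteq> 0 then fst (?a X) / a else snd (?a X) / b)" for X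
    have col: "fst (?a X) = \<xi> X * a" "snd (?a X) = \<xi> X * b" if "X \<in> set Xs" for X
    proof -
      have "a * snd (?a X) = b * fst (?a X)"
      proof -
        have "?a X0 \<in> set (map ?a Xs)" "?a X \<in> set (map ?a Xs)" using X0(1) that by simp_all
        from gdet_zero[OF z this] show ?thesis by (simp add: ab)
      qed
      thus "fst (?a X) = \<xi> X * a" "snd (?a X) = \<xi> X * b" using n0 by (auto simp: \<xi>_def field_simps)
    qed
    define w where "w Y = a * snd (?b Y) - b * fst (?b Y)" for Y
    have dX: "cmod (det X) = cmod (\<xi> X) * cmod (w X)" if "X \<in> set Xs" for X
      unfolding det_app[OF u, symmetric] col[OF that] w_def norm_mult[symmetric] by (simp add: algebra_simps)
    have ws: "wsum (?a X) (map ?b Xs) = (cmod (\<xi> X))\<^sup>2 * (\<Sum>Y\<leftarrow>Xs. (cmod (w Y))\<^sup>2)" if "X \<in> set Xs" for X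
    proof -
      have "wsum (?a X) (map ?b Ys) = (cmod (\<xi> X))\<^sup>2 * (\<Sum>Y\<leftarrow>Ys. (cmod (w Y))\<^sup>2)" for Ys
      proof (induction Ys)
        case (Cons Y Ys)
        have "fst (?a X) * snd (?b Y) - snd (?a X) * fst (?b Y) = \<xi> X * w Y"
          unfolding col[OF that] w_def by (simp add: algebra_simps)
        thus ?case using Cons
          by (simp add: wsum_def case_prod_beta norm_mult power_mult_distrib distrib_left)
      qed (simp add: wsum_def)
      thus ?thesis .
    qed
    have "(\<Sum>X\<leftarrow>Xs. cmod (det X))\<^sup>2 = (\<Sum>X\<leftarrow>Xs. cmod (\<xi> X) * cmod (w X))\<^sup>2"
      using dX by (intro arg_cong[where f="\<lambda>t. t\<^sup>2"] arg_cong[where f=sum_list] map_cong) auto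
    also have "\<dots> \<le> (\<Sum>X\<leftarrow>Xs. (cmod (\<xi> X))\<^sup>2) * (\<Sum>Y\<leftarrow>Xs. (cmod (w Y))\<^sup>2)"
      by (rule sum_list_cauchy_schwarz)
    also have "\<dots> = (\<Sum>X\<leftarrow>Xs. wsum (?a X) (map ?b Xs))"
      unfolding sum_list_mult_const[symmetric] using ws by (intro arg_cong[where f=sum_list] map_cong) auto
    finally show ?thesis .
  qed
  thus ?thesis unfolding gdet_append z by (simp add: comp_def)
qed

text \<open>This supplies a unit direction whose pullback through a filter stays traceless.\<close>

lemma exists_orthogonal_unit:
  fixes a b c :: real
  obtains x y z where "x\<^sup>2 + y\<^sup>2 + z\<^sup>2 = 1" "a * x + b * y + c * z = 0"
proof (cases "a = 0 \<and> b = 0")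
  case True thus ?thesis using that[of 1 0 0] by simp
next
  case False
  define r where "r = sqrt (a\<^sup>2 + b\<^sup>2)"
  have "r > 0" unfolding r_def using False by (simp add: sum_power2_gt_zero_iff)
  moreover have "r\<^sup>2 = a\<^sup>2 + b\<^sup>2" by (simp add: r_def)
  ultimately have "(b / r)\<^sup>2 + (- a / r)\<^sup>2 + 0\<^sup>2 = 1"
    using False by (auto simp: power_divide add_divide_distrib[symmetric])
  thus ?thesis using that[of "b / r" "- a / r" 0] by (simp add: mult.commute)
qed

text \<open>\<open>bell_ensemble\<close> bounds the cost for every unit direction, which leaves the
  freedom to pick one compatible with the filter \<open>B\<close>. Undoing the filters divides both
  the squared cost and the determinant by |det A det B|^2.\<close>

lemma ensemble_le_neg_det_chan:
  assumes nd: "\<And>p q. (cmod p)\<^sup>2 + (cmod q)\<^sup>2 = 1 \<Longrightarrow> gdet (map (app p q) Xs) > 0"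
  obtains Ys x y z where "same_ens Xs Ys" "x\<^sup>2 + y\<^sup>2 + z\<^sup>2 = 1"
    "(\<Sum>Y\<leftarrow>Ys. cmod (det Y))\<^sup>2 \<le> - Re (det (chan Xs (herm 0 x y z)))"
proof -
  obtain A B where A: "det A \<noteq> 0" and B: "det B \<noteq> 0"
    and one: "chan (map (\<lambda>X. A ** X ** B) Xs) (mat 1) = mat 1"
    and tr: "\<And>x y z. trace (chan (map (\<lambda>X. A ** X ** B) Xs) (herm 0 x y z)) = 0"
    using doubly_stochastic_frame[OF nd] by metis
  obtain Zs where Zs: "same_ens (map (\<lambda>X. A ** X ** B) Xs) Zs"
    and Zc: "\<And>x y z. x\<^sup>2 + y\<^sup>2 + z\<^sup>2 = 1 \<Longrightarrow>
      (\<Sum>Z\<leftarrow>Zs. cmod (det Z))\<^sup>2 \<le> - Re (det (chan (map (\<lambda>X. A ** X ** B) Xs) (herm 0 x y z)))"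
    using bell_ensemble[OF one tr] by metis
  obtain A' where A': "A' ** A = mat 1" using A invertible_det_nz[of A] unfolding invertible_def by blast
  obtain B' where B': "B ** B' = mat 1" "B' ** B = mat 1" using B invertible_det_nz[of B] unfolding invertible_def by blast
  have "det (A' ** A) = 1" "det (B ** B') = 1" unfolding A' B' by simp_all
  hence dA': "det A' = 1 / det A" and dB': "det B' = 1 / det B" using A B by (simp_all add: det_mul field_simps)
  define Ys where "Ys = map (\<lambda>Z. A' ** Z ** B') Zs"
  have "A' ** (A ** X ** B) ** B' = X" for X
  proof -
    have "A' ** (A ** X ** B) ** B' = (A' ** A) ** X ** (B ** B')" by (simp add: matrix_mul_assoc)
    thus ?thesis by (simp add: A' B')
  qed
  hence "map (\<lambda>X. A' ** X ** B') (map (\<lambda>X. A ** X ** B) Xs) = Xs" by (simp add: comp_def)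
  hence ens: "same_ens Xs Ys" using same_ens_map[OF Zs, of A' B'] by (simp add: Ys_def)
  have h: "\<exists>t x y z. B' ** herm t0 x0 y0 z0 ** dag B' = herm t x y z" for t0 x0 y0 z0
    by (metis dag_conj_self_adjoint dag_herm herm_cases)
  obtain a1 b1 c1 d1 where 1: "B' ** herm 0 1 0 0 ** dag B' = herm a1 b1 c1 d1" using h by blast
  obtain a2 b2 c2 d2 where 2: "B' ** herm 0 0 1 0 ** dag B' = herm a2 b2 c2 d2" using h by blast
  obtain a3 b3 c3 d3 where 3: "B' ** herm 0 0 0 1 ** dag B' = herm a3 b3 c3 d3" using h by blast
  \<comment> \<open>The linear condition says that \<open>B' ** N ** dag B'\<close> has trace
    zero.\<close>
  obtain x y z where n: "x\<^sup>2 + y\<^sup>2 + z\<^sup>2 = 1" "a1 * x + a2 * y + a3 * z = 0"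
    by (rule exists_orthogonal_unit)
  define N where "N = herm 0 x y z"
  have N: "N = x *\<^sub>R herm 0 1 0 0 + y *\<^sub>R herm 0 0 1 0 + z *\<^sub>R herm 0 0 0 1"
    by (simp add: N_def herm_scale herm_add)
  have "B' ** N ** dag B' = x *\<^sub>R herm a1 b1 c1 d1 + y *\<^sub>R herm a2 b2 c2 d2 + z *\<^sub>R herm a3 b3 c3 d3"
    unfolding N mat2_add_mult mat2_scale_mult 1 2 3 ..
  then obtain b c d where S: "B' ** N ** dag B' = herm 0 b c d"
    using n(2) by (simp add: herm_scale herm_add mult.commute)
  \<comment> \<open>Multiplication by |det B| restores unit Bloch length after the pullback.\<close>
  define \<delta> where "\<delta> = cmod (det B)"
  have \<delta>: "\<delta> > 0" using B by (simp add: \<delta>_def)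
  have "Re (det (B' ** N ** dag B')) = - ((1 / \<delta>)\<^sup>2)"
    unfolding Re_det_conj by (simp add: dB' norm_divide \<delta>_def N_def det_herm n)
  hence "b\<^sup>2 + c\<^sup>2 + d\<^sup>2 = (1 / \<delta>)\<^sup>2" unfolding S det_herm by simp
  hence un: "(\<delta> * b)\<^sup>2 + (\<delta> * c)\<^sup>2 + (\<delta> * d)\<^sup>2 = 1"
    using \<delta> by (simp add: power_mult_distrib distrib_left[symmetric] power_divide)
  have "herm 0 (\<delta> * b) (\<delta> * c) (\<delta> * d) = \<delta> *\<^sub>R (B' ** N ** dag B')"
    by (simp add: S herm_scale)
  moreover have "B ** (B' ** N ** dag B') ** dag B = (B ** B') ** N ** dag (B ** B')"
    by (simp add: dag_mult matrix_mul_assoc)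
  ultimately have BB: "B ** herm 0 (\<delta> * b) (\<delta> * c) (\<delta> * d) ** dag B = \<delta> *\<^sub>R N"
    by (simp add: mat2_scale_mult B')
  have dsc: "Re (det (\<delta> *\<^sub>R Q)) = \<delta>\<^sup>2 * Re (det Q)" for Q :: "complex^2^2"
    by (simp add: det_2 power2_eq_square algebra_simps)
  have cd: "Re (det (chan (map (\<lambda>X. A ** X ** B) Xs) (herm 0 (\<delta> * b) (\<delta> * c) (\<delta> * d))))
      = (cmod (det A))\<^sup>2 * (\<delta>\<^sup>2 * Re (det (chan Xs N)))"
    unfolding chan_map Re_det_conj BB chan_scale dsc ..
  have "(\<Sum>Y\<leftarrow>Ys. cmod (det Y)) = (\<Sum>Z\<leftarrow>Zs. cmod (det Z)) * (1 / (cmod (det A) * \<delta>))"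
    unfolding Ys_def sum_list_mult_const[symmetric] by (simp add: comp_def det_mul dA' dB' norm_mult norm_divide \<delta>_def)
  hence "(\<Sum>Y\<leftarrow>Ys. cmod (det Y))\<^sup>2 = (\<Sum>Z\<leftarrow>Zs. cmod (det Z))\<^sup>2 / ((cmod (det A))\<^sup>2 * \<delta>\<^sup>2)"
    by (simp add: power_divide power_mult_distrib)
  also have "\<dots> \<le> - Re (det (chan Xs N))"
    using Zc[OF un] A \<delta> unfolding cd by (simp add: pos_divide_le_eq mult_ac)
  finally show ?thesis using that[OF ens n(1)] by (simp add: N_def)
qed

text \<open>The right-hand side is det L(1). In the nondegenerate case (p, q) is the eigenvector of
  n for the eigenvalue 1, so the two branches have determinants det L((1 + n)/2) and det L((1 -
  n)/2).\<close>

lemma single_vector_tradeoff: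
  "\<exists>Ys p q. same_ens Xs Ys \<and> (cmod p)\<^sup>2 + (cmod q)\<^sup>2 = 1 \<and>
    (\<Sum>Y\<leftarrow>Ys. cmod (det Y))\<^sup>2
      + (sqrt (gdet (map (app p q) Xs)) + sqrt (gdet (map (app (- cnj q) (cnj p)) Xs)))\<^sup>2
    \<le> gdet (map (app 1 0) Xs @ map (app 0 1) Xs)"
proof -
  have rhs: "Re (det (chan Xs (mat 1))) = gdet (map (app 1 0) Xs @ map (app 0 1) Xs)"
    using det_chan_mat1[of 1 0 Xs] by simp
  show ?thesis
  proof (cases "\<exists>p q. (cmod p)\<^sup>2 + (cmod q)\<^sup>2 = 1 \<and> gdet (map (app p q) Xs) = 0")
    case True
    then obtain p q where pq: "(cmod p)\<^sup>2 + (cmod q)\<^sup>2 = 1" "gdet (map (app p q) Xs) = 0" by blast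
    have "(\<Sum>X\<leftarrow>Xs. cmod (det X))\<^sup>2 + gdet (map (app (- cnj q) (cnj p)) Xs)
      \<le> gdet (map (app 1 0) Xs @ map (app 0 1) Xs)"
      using single_vector_tradeoff_degenerate[OF pq] det_chan_mat1[OF pq(1), of Xs] unfolding rhs[symmetric] by simp
    thus ?thesis using pq by (intro exI[of _ Xs] exI[of _ p] exI[of _ q]) (simp add: same_ens_def gdet_nonneg)
  next
    case False
    hence nd: "gdet (map (app p q) Xs) > 0" if "(cmod p)\<^sup>2 + (cmod q)\<^sup>2 = 1" for p q
      using that gdet_nonneg[of "map (app p q) Xs"] by (auto simp: less_le)
    obtain Ys x y z where Y: "same_ens Xs Ys" "x\<^sup>2 + y\<^sup>2 + z\<^sup>2 = 1"
      "(\<Sum>Y\<leftarrow>Ys. cmod (det Y))\<^sup>2 \<le> - Re (det (chan Xs (herm 0 x y z)))"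
      using ensemble_le_neg_det_chan[OF nd] by metis
    obtain p q where pq: "(cmod p)\<^sup>2 + (cmod q)\<^sup>2 = 1" "herm 1 x y z = 2 *\<^sub>R outer p q"
      using rank_one_herm[OF Y(2)] by blast
    define E N where "E = chan Xs (mat 1)" and "N = chan Xs (herm 0 x y z)"
    define f g where "f = gdet (map (app p q) Xs)" and "g = gdet (map (app (- cnj q) (cnj p)) Xs)"
    have o1: "outer p q = (1/2) *\<^sub>R (mat 1 + herm 0 x y z)"
    proof -
      have "mat 1 + herm 0 x y z = herm 1 x y z" by (simp add: mat1_herm herm_add)
      thus ?thesis unfolding pq(2) by simp
    qed
    have "outer (- cnj q) (cnj p) = mat 1 - outer p q" using outer_complete[OF pq(1)] by (simp add: eq_diff_eq add.commute)
    also have "\<dots> = (1/2) *\<^sub>R (mat 1 + (- 1) *\<^sub>R herm 0 x y z)"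
      unfolding o1 by (simp add: mat1_herm herm_scale herm_add mat2_eq_iff complex_eq_iff)
    finally have o2: "outer (- cnj q) (cnj p) = (1/2) *\<^sub>R (mat 1 + (- 1) *\<^sub>R herm 0 x y z)" .
    have f: "f = Re (det ((1/2) *\<^sub>R (E + N)))"
      using arg_cong[OF chan_outer[of Xs p q], of "\<lambda>M. Re (det M)"]
      unfolding o1 chan_scale chan_add det_gmat f_def E_def N_def by simp
    have g: "g = Re (det ((1/2) *\<^sub>R (E + (- 1) *\<^sub>R N)))"
      using arg_cong[OF chan_outer[of Xs "- cnj q" "cnj p"], of "\<lambda>M. Re (det M)"]
      unfolding o2 chan_scale chan_add det_gmat g_def E_def N_def by simp
    \<comment> \<open>The two-by-two determinant is a quadratic form, so the parallelogram law holds
      for E and N.\<close>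
    have fg: "2 * (f + g) = Re (det E) + Re (det N)"
      unfolding f g by (simp add: det_2 field_simps)
    have "(sqrt f + sqrt g)\<^sup>2 \<le> 2 * ((sqrt f)\<^sup>2 + (sqrt g)\<^sup>2)"
      using sum_squares_ge_zero[of "sqrt f - sqrt g" 0] by (simp add: power2_eq_square algebra_simps)
    also have "\<dots> = Re (det E) + Re (det N)" using fg by (simp add: f_def g_def gdet_nonneg)
    finally have "(\<Sum>Y\<leftarrow>Ys. cmod (det Y))\<^sup>2 + (sqrt f + sqrt g)\<^sup>2 \<le> gdet (map (app 1 0) Xs @ map (app 0 1) Xs)"
      using Y(3) rhs unfolding N_def E_def by simp
    thus ?thesis using Y(1) pq(1) unfolding f_def g_def by blast
  qed
qed

section \<open>Concurrence\<close>

definition herm_form :: "nat \<Rightarrow> (nat \<Rightarrow> nat \<Rightarrow> complex) \<Rightarrow> (nat \<Rightarrow> complex) \<Rightarrow> complex" where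
  "herm_form d \<rho> v = (\<Sum>i<d. \<Sum>j<d. cnj (v i) * \<rho> i j * v j)"

lemma herm_form_Suc:
  "herm_form (Suc d) \<rho> (v(d := t)) = herm_form d \<rho> v + cnj t * (\<Sum>j<d. \<rho> d j * v j)
    + t * (\<Sum>i<d. cnj (v i) * \<rho> i d) + cnj t * t * \<rho> d d"
proof -
  have "herm_form (Suc d) \<rho> (v(d := t)) = (\<Sum>i<d. (\<Sum>j<d. cnj (v i) * \<rho> i j * v j) + cnj (v i) * \<rho> i d * t)
     + ((\<Sum>j<d. cnj t * \<rho> d j * v j) + cnj t * \<rho> d d * t)"
    unfolding herm_form_def by simp
  thus ?thesis by (simp add: herm_form_def sum.distrib sum_distrib_left algebra_simps)
qed

text \<open>Cholesky by induction on the dimension: split off the last column, divided by the root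
  of the pivot, and recurse on the Schur complement. Vectors from the smaller dimension are extended
  by 0.\<close>

lemma psd_ensemble:
  assumes "\<And>v. Im (herm_form d \<rho> v) = 0 \<and> Re (herm_form d \<rho> v) \<ge> 0"
  shows "\<exists>\<phi>s. \<forall>a<d. \<forall>b<d. \<rho> a b = (\<Sum>\<phi>\<leftarrow>\<phi>s. \<phi> a * cnj (\<phi> b))"
  using assms
proof (induction d arbitrary: \<rho>)
  case 0 show ?case by simp
next
  case (Suc d)
  define R where "R v = (\<Sum>j<d. \<rho> d j * v j)" for v
  define C where "C v = (\<Sum>i<d. cnj (v i) * \<rho> i d)" for v
  have Q: "Im (herm_form d \<rho> v + cnj t * R v + t * C v + cnj t * t * \<rho> d d) = 0"
    "Re (herm_form d \<rho> v + cnj t * R v + t * C v + cnj t * t * \<rho> d d) \<ge> 0" for v t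
    using Suc.prems[of "v(d := t)"] unfolding herm_form_Suc R_def C_def by auto
  have Q0: "Im (herm_form d \<rho> v) = 0" "Re (herm_form d \<rho> v) \<ge> 0" for v using Q[of v 0] by simp_all
  have dd: "Im (\<rho> d d) = 0" "Re (\<rho> d d) \<ge> 0"
    using Q[of "\<lambda>_. 0" 1] by (simp_all add: herm_form_def R_def C_def)
  \<comment> \<open>Reality of the form at t = 1 and t = i gives the Hermitian symmetry of the last
    row and column.\<close>
  have RC: "C v = cnj (R v)" for v
    using Q(1)[of v 1] Q(1)[of v \<i>] Q0(1)[of v] dd(1) by (simp add: complex_eq_iff)
  have delta: "R (\<lambda>i. if i = j then 1 else 0) = \<rho> d j" "C (\<lambda>i. if i = j then 1 else 0) = \<rho> j d" if "j < d" for j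
  proof -
    have i: "\<rho> d i * (if i = j then 1 else 0) = (if i = j then \<rho> d i else 0)"
      "cnj (if i = j then 1 else 0) * \<rho> i d = (if i = j then \<rho> i d else 0)" for i by simp_all
    show "R (\<lambda>i. if i = j then 1 else 0) = \<rho> d j" "C (\<lambda>i. if i = j then 1 else 0) = \<rho> j d"
      unfolding R_def C_def i using that by simp_all
  qed
  have hd: "\<rho> j d = cnj (\<rho> d j)" if "j < d" for j
    using RC[of "\<lambda>i. if i = j then 1 else 0"] delta[OF that] by simp
  have ext: "(\<Sum>\<phi>\<leftarrow>map (\<lambda>\<phi>. \<phi>(d := 0)) \<phi>s. \<phi> a * cnj (\<phi> b)) =
      (if a = d \<or> b = d then 0 else (\<Sum>\<phi>\<leftarrow>\<phi>s. \<phi> a * cnj (\<phi> b)))" for \<phi>s :: "(nat \<Rightarrow> complex) list" and a b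
    by (induction \<phi>s) auto
  show ?case
  proof (cases "Re (\<rho> d d) = 0")
    case True
    hence z: "\<rho> d d = 0" using dd by (simp add: complex_eq_iff)
    have R0: "R v = 0" for v
    proof (rule ccontr)
      assume n: "R v \<noteq> 0"
      \<comment> \<open>With a zero pivot the form is affine in t; this c drives its value F at t =
        0 down to - F - 2, which is negative.\<close>
      define c where "c = (Re (herm_form d \<rho> v) + 1) / (cmod (R v))\<^sup>2"
      have "Re (cnj (- of_real c * R v) * R v) = - c * (cmod (R v))\<^sup>2"
        "Re (- of_real c * R v * cnj (R v)) = - c * (cmod (R v))\<^sup>2"
        unfolding cmod_sq by (simp_all add: power2_eq_square algebra_simps)
      hence "Re (herm_form d \<rho> v) - 2 * (c * (cmod (R v))\<^sup>2) \<ge> 0"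
        using Q(2)[of v "- of_real c * R v"] unfolding z RC mult_zero_right add_0_right plus_complex.sel by linarith
      moreover have "c * (cmod (R v))\<^sup>2 = Re (herm_form d \<rho> v) + 1" using n by (simp add: c_def)
      ultimately show False using Q0(2)[of v] by linarith
    qed
    have z': "\<rho> d j = 0" "\<rho> j d = 0" if "j < d" for j using delta(1)[OF that] hd[OF that] R0 by auto
    obtain \<phi>s where \<phi>s: "\<forall>a<d. \<forall>b<d. \<rho> a b = (\<Sum>\<phi>\<leftarrow>\<phi>s. \<phi> a * cnj (\<phi> b))"
      using Suc.IH[of \<rho>] Q0 by blast
    show ?thesis
    proof (intro exI[of _ "map (\<lambda>\<phi>. \<phi>(d := 0)) \<phi>s"] allI impI)
      fix a b assume "a < Suc d" "b < Suc d"
      thus "\<rho> a b = (\<Sum>\<phi>\<leftarrow>map (\<lambda>\<phi>. \<phi>(d := 0)) \<phi>s. \<phi> a * cnj (\<phi> b))"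
        unfolding ext using \<phi>s z z' by (auto simp: less_Suc_eq)
    qed
  next
    case False
    define r where "r = Re (\<rho> d d)"
    have r: "r > 0" "\<rho> d d = of_real r" using False dd by (auto simp: r_def complex_eq_iff)
    \<comment> \<open>The Schur complement: its form at v is that of \<rho> with the last coordinate
      set to the minimising t = - R v / r.\<close>
    define \<sigma> where "\<sigma> i j = \<rho> i j - \<rho> i d * \<rho> d j / of_real r" for i j
    have "herm_form d \<sigma> v = herm_form d \<rho> v - C v * R v / of_real r" for v
      unfolding herm_form_def \<sigma>_def C_def R_def sum_product sum_divide_distrib sum_subtractf[symmetric]
      by (intro sum.cong refl) (simp add: algebra_simps)
    moreover have "herm_form d \<rho> v - C v * R v / of_real r
      = herm_form d \<rho> v + cnj (- R v / of_real r) * R v + (- R v / of_real r) * C v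
        + cnj (- R v / of_real r) * (- R v / of_real r) * \<rho> d d" for v
      using r by (simp add: RC field_simps)
    ultimately have "Im (herm_form d \<sigma> v) = 0 \<and> Re (herm_form d \<sigma> v) \<ge> 0" for v
      using Q[where v=v and t="- R v / of_real r"] by presburger
    from Suc.IH[OF this] obtain \<phi>s where \<phi>s: "\<forall>a<d. \<forall>b<d. \<sigma> a b = (\<Sum>\<phi>\<leftarrow>\<phi>s. \<phi> a * cnj (\<phi> b))" by blast
    have s: "complex_of_real (sqrt r) * complex_of_real (sqrt r) = of_real r"
      using r by (simp add: of_real_mult[symmetric] del: of_real_mult)
    show ?thesis
    proof (intro exI[of _ "(\<lambda>i. \<rho> i d / of_real (sqrt r)) # map (\<lambda>\<phi>. \<phi>(d := 0)) \<phi>s"] allI impI)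
      fix a b assume ab: "a < Suc d" "b < Suc d"
      have "\<rho> a d / of_real (sqrt r) * cnj (\<rho> b d / of_real (sqrt r)) = \<rho> a d * cnj (\<rho> b d) / of_real r"
        by (simp add: s)
      moreover have "cnj (\<rho> b d) = \<rho> d b" using ab hd[of b] r(2) by (auto simp: less_Suc_eq)
      ultimately have e: "\<rho> a d / of_real (sqrt r) * cnj (\<rho> b d / of_real (sqrt r)) = \<rho> a d * \<rho> d b / of_real r" by simp
      have "\<rho> a b = \<rho> a d * \<rho> d b / of_real r + (\<Sum>\<phi>\<leftarrow>\<phi>s. \<phi> a * cnj (\<phi> b))" if "a < d" "b < d"
        using \<phi>s that unfolding \<sigma>_def by (simp add: diff_eq_eq add.commute)
      thus "\<rho> a b = (\<Sum>\<phi>\<leftarrow>(\<lambda>i. \<rho> i d / of_real (sqrt r)) # map (\<lambda>\<phi>. \<phi>(d := 0)) \<phi>s. \<phi> a * cnj (\<phi> b))"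
        unfolding list.map sum_list.Cons ext e using ab r by (auto simp: less_Suc_eq)
    qed
  qed
qed

section \<open>Concurrence of unnormalised vectors\<close>

text \<open>The qubit is the leading tensor factor, so entries y and d + y form a column of the 2 x
  d amplitude matrix.\<close>

definition cols :: "nat \<Rightarrow> (nat \<Rightarrow> complex) \<Rightarrow> (complex \<times> complex) list" where
  "cols d \<phi> = map (\<lambda>y. (\<phi> y, \<phi> (d + y))) [0..<d]"

text \<open>The concurrence of an unnormalised vector, homogeneous of degree two.\<close>

definition cost :: "nat \<Rightarrow> (nat \<Rightarrow> complex) \<Rightarrow> real" where
  "cost d \<phi> = 2 * sqrt (gdet (cols d \<phi>))"

lemma cost_nonneg: "cost d \<phi> \<ge> 0"
  by (simp add: cost_def gdet_nonneg)

lemma sum_list_upt: "(\<Sum>y\<leftarrow>[0..<d]. f y) = (\<Sum>y<d. f y :: 'a::comm_monoid_add)"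
  by (simp add: interv_sum_list_conv_sum_set_nat atLeast0LessThan)

lemma gdet_cols: "gdet (cols d \<phi>) = (\<Sum>y<d. (cmod (\<phi> y))\<^sup>2) * (\<Sum>y<d. (cmod (\<phi> (d + y)))\<^sup>2)
    - (cmod (\<Sum>y<d. \<phi> y * cnj (\<phi> (d + y))))\<^sup>2"
  by (simp add: gdet_def cols_def comp_def sum_list_upt)

lemma cost_scale: "cost d (\<lambda>j. c * \<phi> j) = (cmod c)\<^sup>2 * cost d \<phi>"
proof -
  have "(\<Sum>y<d. c * \<phi> y * cnj (c * \<phi> (d + y))) = c * cnj c * (\<Sum>y<d. \<phi> y * cnj (\<phi> (d + y)))"
    by (simp add: sum_distrib_left algebra_simps)
  hence "gdet (cols d (\<lambda>j. c * \<phi> j)) = ((cmod c)\<^sup>2)\<^sup>2 * gdet (cols d \<phi>)"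
    unfolding gdet_cols by (simp add: norm_mult power_mult_distrib sum_distrib_left[symmetric] power2_eq_square algebra_simps)
  thus ?thesis unfolding cost_def by (simp only: real_sqrt_mult real_sqrt_abs abs_power2 mult_ac)
qed

lemma sum_double: "(\<Sum>y<2 * d. f y) = (\<Sum>y<d. f y + f (d + y) :: 'a::comm_monoid_add)" for d :: nat
proof -
  have "(\<Sum>y<2 * d. f y) = (\<Sum>y<d. f y) + (\<Sum>y\<in>{d..<d + d}. f y)"
    by (simp add: sum.atLeastLessThan_concat lessThan_atLeast0 mult_2)
  also have "(\<Sum>y\<in>{d..<d + d}. f y) = (\<Sum>y<d. f (d + y))"
    using sum.shift_bounds_nat_ivl[of f 0 d d] by (simp add: lessThan_atLeast0 add.commute)
  finally show ?thesis by (simp add: sum.distrib)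
qed

text \<open>A qubit state r of trace one satisfies 1 - tr (r^2) = 2 det r.\<close>

lemma conc_pure_cost:
  assumes "unit_vec (2 * d) \<psi>" shows "conc_pure 2 d \<psi> = cost d \<psi>"
proof -
  define N M S where "N = (\<Sum>y<d. (cmod (\<psi> y))\<^sup>2)" and "M = (\<Sum>y<d. (cmod (\<psi> (d + y)))\<^sup>2)"
    and "S = (\<Sum>y<d. \<psi> y * cnj (\<psi> (d + y)))"
  have NM: "N + M = 1" using assms by (simp add: unit_vec_def sum_double N_def M_def sum.distrib)
  define T where "T = ptrace2 2 d (proj \<psi>)"
  have T: "T 0 0 = of_real N" "T 1 1 = of_real M" "T 0 1 = S" "T 1 0 = cnj S"
    by (simp_all add: T_def ptrace2_def proj_def N_def M_def S_def mult_cnj_cmod mult.commute)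
  have tr: "Re (mtrace 2 (msquare 2 T)) = N\<^sup>2 + M\<^sup>2 + 2 * (cmod S)\<^sup>2"
    unfolding cmod_sq
    by (simp add: mtrace_def msquare_def lessThan_Suc numeral_2_eq_2 T[unfolded One_nat_def] power2_eq_square algebra_simps)
  have "(N + M) * (N + M) = 1" using NM by simp
  hence "2 * (1 - Re (mtrace 2 (msquare 2 T))) = 4 * (N * M - (cmod S)\<^sup>2)"
    unfolding tr by (simp add: power2_eq_square algebra_simps)
  thus ?thesis unfolding conc_pure_def T_def[symmetric] cost_def gdet_cols N_def[symmetric] M_def[symmetric] S_def[symmetric]
    by (simp only: real_sqrt_mult real_sqrt_four)
qed

lemma cost_zero: "(\<And>a. a < 2 * d \<Longrightarrow> \<phi> a = 0) \<Longrightarrow> cost d \<phi> = 0"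
  by (simp add: cost_def gdet_cols)

lemma ensemble_average_nonneg:
  fixes m :: nat
  assumes "(\<forall>i<m. p i \<ge> 0 \<and> unit_vec (2 * d) (\<psi> i))"
  shows "0 \<le> (\<Sum>i<m. p i * conc_pure 2 d (\<psi> i))"
  using assms by (intro sum_nonneg mult_nonneg_nonneg) (auto simp: conc_pure_cost cost_nonneg)

text \<open>\<open>cost\<close> is homogeneous of degree two, so with the squared norms as
  probabilities the average concurrence is the plain sum of the costs.\<close>

lemma normalise_ensemble:
  assumes \<rho>: "\<And>a b. a < 2 * d \<Longrightarrow> b < 2 * d \<Longrightarrow> \<rho> a b = (\<Sum>\<phi>\<leftarrow>\<phi>s. \<phi> a * cnj (\<phi> b))"
    and tr: "(\<Sum>a<2 * d. \<rho> a a) = 1"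
  obtains m :: nat and p \<psi> where "\<forall>i<m. p i \<ge> 0 \<and> unit_vec (2 * d) (\<psi> i)" "(\<Sum>i<m. p i) = (1::real)"
    "\<forall>a<2 * d. \<forall>b<2 * d. \<rho> a b = (\<Sum>i<m. complex_of_real (p i) * proj (\<psi> i) a b)"
    "(\<Sum>i<m. p i * conc_pure 2 d (\<psi> i)) = (\<Sum>\<phi>\<leftarrow>\<phi>s. cost d \<phi>)"
proof -
  define m where "m = length \<phi>s"
  define p where "p i = (\<Sum>a<2 * d. (cmod ((\<phi>s ! i) a))\<^sup>2)" for i
  \<comment> \<open>Members of weight zero still need a unit vector; a basis vector stands in, which
    exists because the trace forces d > 0.\<close>
  define \<psi> where "\<psi> i = (if p i = 0 then (\<lambda>j. if j = 0 then 1 else 0)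
     else (\<lambda>j. of_real (1 / sqrt (p i)) * (\<phi>s ! i) j))" for i
  have d: "d > 0" using tr by (cases d) auto
  have p0: "p i \<ge> 0" for i by (simp add: p_def sum_nonneg)
  have pz: "(\<phi>s ! i) a = 0" if "p i = 0" "a < 2 * d" for i a
    using that by (simp add: p_def sum_nonneg_eq_0_iff)
  have unit: "unit_vec (2 * d) (\<psi> i)" for i
  proof (cases "p i = 0")
    case True
    have "(cmod (if j = 0 then 1 else 0))\<^sup>2 = (if j = 0 then 1 else 0 :: real)" for j :: nat by simp
    thus ?thesis using True d by (simp add: \<psi>_def unit_vec_def)
  next
    case False
    have "(\<Sum>a<2 * d. (cmod (of_real (1 / sqrt (p i)) * (\<phi>s ! i) a))\<^sup>2) = (1 / sqrt (p i))\<^sup>2 * p i"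
      unfolding p_def[of i] norm_mult power_mult_distrib sum_distrib_left[symmetric] norm_of_real power2_abs ..
    also have "\<dots> = 1" using False p0[of i] by (simp add: power_divide)
    finally show ?thesis using False by (simp add: \<psi>_def unit_vec_def)
  qed
  have pr: "complex_of_real (p i) * proj (\<psi> i) a b = (\<phi>s ! i) a * cnj ((\<phi>s ! i) b)"
    if "a < 2 * d" "b < 2 * d" for i a b
  proof (cases "p i = 0")
    case True thus ?thesis using pz[OF True that(1)] by simp
  next
    case False
    define c where "c = complex_of_real (1 / sqrt (p i))"
    have \<psi>: "\<psi> i = (\<lambda>j. c * (\<phi>s ! i) j)" using False by (simp add: \<psi>_def c_def)
    have cc: "cnj c = c" by (simp add: c_def)
    have "complex_of_real (p i) * proj (\<psi> i) a b
      = complex_of_real (p i) * (c * c) * ((\<phi>s ! i) a * cnj ((\<phi>s ! i) b))"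
      unfolding \<psi> proj_def complex_cnj_mult cc by (simp only: mult_ac)
    also have "complex_of_real (p i) * (c * c) = of_real (p i * (1 / sqrt (p i) * (1 / sqrt (p i))))"
      unfolding c_def of_real_mult ..
    also have "p i * (1 / sqrt (p i) * (1 / sqrt (p i))) = 1" using False p0[of i] by simp
    finally show ?thesis by simp
  qed
  have co: "p i * conc_pure 2 d (\<psi> i) = cost d (\<phi>s ! i)" for i
  proof (cases "p i = 0")
    case True thus ?thesis using cost_zero[of d "\<phi>s ! i"] pz by simp
  next
    case False
    have "conc_pure 2 d (\<psi> i) = (1 / sqrt (p i))\<^sup>2 * cost d (\<phi>s ! i)"
    proof -
      have \<psi>: "\<psi> i = (\<lambda>j. of_real (1 / sqrt (p i)) * (\<phi>s ! i) j)" using False by (simp add: \<psi>_def)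
      show ?thesis unfolding conc_pure_cost[OF unit] unfolding \<psi> cost_scale norm_of_real power2_abs ..
    qed
    thus ?thesis using False p0[of i] by (simp add: power_divide)
  qed
  have nth: "(\<Sum>\<phi>\<leftarrow>\<phi>s. f \<phi>) = (\<Sum>i<m. f (\<phi>s ! i))" for f :: "(nat \<Rightarrow> complex) \<Rightarrow> 'b::comm_monoid_add"
    by (simp add: sum_list_sum_nth m_def lessThan_atLeast0)
  have "complex_of_real (\<Sum>i<m. p i) = (\<Sum>i<m. \<Sum>a<2 * d. (\<phi>s ! i) a * cnj ((\<phi>s ! i) a))"
    by (simp add: p_def mult_cnj_cmod)
  also have "\<dots> = (\<Sum>a<2 * d. \<Sum>i<m. (\<phi>s ! i) a * cnj ((\<phi>s ! i) a))" by (rule sum.swap)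
  also have "\<dots> = (\<Sum>a<2 * d. \<rho> a a)" by (intro sum.cong refl) (simp add: \<rho> nth)
  finally have "complex_of_real (\<Sum>i<m. p i) = of_real 1" using tr by simp
  hence p1: "(\<Sum>i<m. p i) = 1" unfolding of_real_eq_iff .
  have "\<forall>a<2 * d. \<forall>b<2 * d. \<rho> a b = (\<Sum>i<m. complex_of_real (p i) * proj (\<psi> i) a b)"
    by (simp add: pr \<rho> nth)
  moreover have "(\<Sum>i<m. p i * conc_pure 2 d (\<psi> i)) = (\<Sum>\<phi>\<leftarrow>\<phi>s. cost d \<phi>)" unfolding co nth ..
  ultimately show ?thesis using that[of m p \<psi>] p0 unit p1 by blast
qed

text \<open>The normalised list is one competitor in the infimum, which is bounded below by
  0.\<close>

lemma conc_le:
  assumes "\<And>a b. a < 2 * d \<Longrightarrow> b < 2 * d \<Longrightarrow> \<rho> a b = (\<Sum>\<phi>\<leftarrow>\<phi>s. \<phi> a * cnj (\<phi> b))"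
    and "(\<Sum>a<2 * d. \<rho> a a) = 1"
  shows "conc 2 d \<rho> \<le> (\<Sum>\<phi>\<leftarrow>\<phi>s. cost d \<phi>)"
proof -
  obtain m :: nat and p \<psi> where e: "\<forall>i<m. p i \<ge> 0 \<and> unit_vec (2 * d) (\<psi> i)" "(\<Sum>i<m. p i) = (1::real)"
    "\<forall>a<2 * d. \<forall>b<2 * d. \<rho> a b = (\<Sum>i<m. complex_of_real (p i) * proj (\<psi> i) a b)"
    and c: "(\<Sum>i<m. p i * conc_pure 2 d (\<psi> i)) = (\<Sum>\<phi>\<leftarrow>\<phi>s. cost d \<phi>)"
    by (rule normalise_ensemble[OF assms])
  show ?thesis unfolding conc_def c[symmetric]
  proof (rule cInf_lower)
    show "bdd_below {(\<Sum>i<m. p i * conc_pure 2 d (\<psi> i)) |(m::nat) p \<psi>.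
       (\<forall>i<m. p i \<ge> 0 \<and> unit_vec (2 * d) (\<psi> i)) \<and> (\<Sum>i<m. p i) = 1 \<and>
       (\<forall>a<2 * d. \<forall>b<2 * d. \<rho> a b = (\<Sum>i<m. complex_of_real (p i) * proj (\<psi> i) a b))}"
      by (rule bdd_belowI[of _ 0]) (auto intro: ensemble_average_nonneg)
  qed (use e in blast)
qed

section \<open>Monogamy of concurrence\<close>

text \<open>This is \<open>single_vector_tradeoff\<close> in terms of amplitudes: the matrices Y
  become vectors of AB, and the two branches of B become vectors of AC.\<close>

lemma pure_monogamy:
  fixes \<phi> :: "nat \<Rightarrow> complex"
  assumes D: "D > 0"
  shows "\<exists>\<alpha>s \<beta>s. (\<forall>a<4. \<forall>b<4. ptrace2 4 D (proj \<phi>) a b = (\<Sum>\<alpha>\<leftarrow>\<alpha>s. \<alpha> a * cnj (\<alpha> b))) \<and>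
    (\<forall>a<2*D. \<forall>b<2*D. ptrace_mid 2 2 D (proj \<phi>) a b = (\<Sum>\<beta>\<leftarrow>\<beta>s. \<beta> a * cnj (\<beta> b))) \<and>
    (\<Sum>\<alpha>\<leftarrow>\<alpha>s. cost 2 \<alpha>)\<^sup>2 + (\<Sum>\<beta>\<leftarrow>\<beta>s. cost D \<beta>)\<^sup>2 \<le> (cost (2 * D) \<phi>)\<^sup>2"
proof -
  \<comment> \<open>The amplitude of (a, b, c) has index (2 a + b) D + c; A labels the rows and B
    the columns.\<close>
  define X :: "nat \<Rightarrow> complex^2^2" where
    "X c = vector [vector [\<phi> c, \<phi> (D + c)], vector [\<phi> (2 * D + c), \<phi> (3 * D + c)]]" for c
  have Xn: "X c $ 1 $ 1 = \<phi> c" "X c $ 1 $ 2 = \<phi> (D + c)" "X c $ 2 $ 1 = \<phi> (2 * D + c)" "X c $ 2 $ 2 = \<phi> (3 * D + c)" for c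
    by (simp_all add: X_def)
  define Xs where "Xs = map X [0..<D]"
  obtain Ys p q where Y: "same_ens Xs Ys" and pq: "(cmod p)\<^sup>2 + (cmod q)\<^sup>2 = 1" and le:
    "(\<Sum>Y\<leftarrow>Ys. cmod (det Y))\<^sup>2
      + (sqrt (gdet (map (app p q) Xs)) + sqrt (gdet (map (app (- cnj q) (cnj p)) Xs)))\<^sup>2
    \<le> gdet (map (app 1 0) Xs @ map (app 0 1) Xs)"
    using single_vector_tradeoff[of Xs] by blast
  define ix :: "nat \<Rightarrow> 2" where "ix a = (if a = 0 then 1 else 2)" for a
  define vec :: "complex^2^2 \<Rightarrow> nat \<Rightarrow> complex" where "vec Y k = Y $ ix (k div 2) $ ix (k mod 2)" for Y k
  define \<beta> where "\<beta> p q k = (if k < D then fst (app p q (X k)) else snd (app p q (X (k - D))))" for p q k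
  have AB: "ptrace2 4 D (proj \<phi>) a b = (\<Sum>\<alpha>\<leftarrow>map vec Ys. \<alpha> a * cnj (\<alpha> b))" if "a < 4" "b < 4" for a b
  proof -
    have vX: "vec (X y) k = \<phi> (k * D + y)" if "k < 4" for k y
    proof -
      have "k \<in> {0, 1, 2, 3}" using that by auto
      thus ?thesis by (auto simp: vec_def ix_def Xn)
    qed
    have "(\<Sum>\<alpha>\<leftarrow>map vec Ys. \<alpha> a * cnj (\<alpha> b)) = (\<Sum>\<alpha>\<leftarrow>map vec Xs. \<alpha> a * cnj (\<alpha> b))"
      using Y unfolding same_ens_def by (simp add: comp_def vec_def)
    also have "\<dots> = (\<Sum>y<D. vec (X y) a * cnj (vec (X y) b))"
      unfolding Xs_def map_map comp_def sum_list_upt ..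
    finally show ?thesis using that by (simp add: ptrace2_def proj_def vX)
  qed
  have costY: "cost 2 (vec Y) = 2 * cmod (det Y)" for Y
  proof -
    have "cols 2 (vec Y) = [(Y$1$1, Y$2$1), (Y$1$2, Y$2$2)]"
    proof -
      have "[0..<2] = [0, 1::nat]" by (simp add: upt_rec)
      thus ?thesis by (simp add: cols_def vec_def ix_def)
    qed
    thus ?thesis by (simp add: cost_def gdet_Cons gdet_def[of "[]"] wsum_def det_2 mult.commute)
  qed
  have cost\<beta>: "cost D (\<beta> p q) = 2 * sqrt (gdet (map (app p q) Xs))" for p q
  proof -
    have "cols D (\<beta> p q) = map (app p q) Xs" by (simp add: cols_def \<beta>_def Xs_def)
    thus ?thesis by (simp add: cost_def)
  qed
  have cost\<phi>: "cost (2 * D) \<phi> = 2 * sqrt (gdet (map (app 1 0) Xs @ map (app 0 1) Xs))"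
  proof -
    have "[0..<2 * D] = [0..<D] @ map (\<lambda>i. i + D) [0..<D]"
      by (simp add: map_add_upt mult_2 upt_add_eq_append[of 0 D D, symmetric])
    hence "cols (2 * D) \<phi> = map (app 1 0) Xs @ map (app 0 1) Xs"
      by (simp add: cols_def Xs_def app_def Xn add_ac)
    thus ?thesis by (simp add: cost_def)
  qed
  \<comment> \<open>The two branches come from a unitary change of basis on B, which leaves the
    partial trace over B unchanged.\<close>
  have AC: "ptrace_mid 2 2 D (proj \<phi>) a b = (\<Sum>\<beta>\<leftarrow>[\<beta> p q, \<beta> (- cnj q) (cnj p)]. \<beta> a * cnj (\<beta> b))"
    if "a < 2 * D" "b < 2 * D" for a b
  proof -
    define x where "x y k = \<phi> ((k div D * 2 + y) * D + k mod D)" for y k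
    have bx: "\<beta> p q k = x 0 k * p + x 1 k * q" if "k < 2 * D" for p q k
    proof (cases "k < D")
      case True thus ?thesis by (simp add: \<beta>_def x_def app_def Xn)
    next
      case False
      hence "k div D = 1" "k mod D = k - D" using that D by (simp_all add: div_nat_eqI le_mod_geq)
      moreover have "2 * D + (k - D) = k + D" "3 * D + (k - D) = k + 2 * D" using False by simp_all
      ultimately show ?thesis using False by (simp add: \<beta>_def x_def app_def Xn add_ac mult_2)
    qed
    have 1: "p * cnj p + q * cnj q = 1"
      unfolding mult_cnj_cmod of_real_add[symmetric] pq by simp
    have "(\<Sum>\<beta>\<leftarrow>[\<beta> p q, \<beta> (- cnj q) (cnj p)]. \<beta> a * cnj (\<beta> b))
      = (x 0 a * cnj (x 0 b) + x 1 a * cnj (x 1 b)) * (p * cnj p + q * cnj q)"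
      using that by (simp add: bx algebra_simps)
    also have "\<dots> = ptrace_mid 2 2 D (proj \<phi>) a b"
      unfolding 1 ptrace_mid_def proj_def x_def by (simp add: numeral_2_eq_2)
    finally show ?thesis by simp
  qed
  have "(\<Sum>\<alpha>\<leftarrow>map vec Ys. cost 2 \<alpha>) = 2 * (\<Sum>Y\<leftarrow>Ys. cmod (det Y))"
    by (simp add: comp_def costY sum_list_const_mult)
  moreover have "(\<Sum>\<beta>\<leftarrow>[\<beta> p q, \<beta> (- cnj q) (cnj p)]. cost D \<beta>)
     = 2 * (sqrt (gdet (map (app p q) Xs)) + sqrt (gdet (map (app (- cnj q) (cnj p)) Xs)))"
    by (simp add: cost\<beta>)
  moreover have "(cost (2 * D) \<phi>)\<^sup>2 = 4 * gdet (map (app 1 0) Xs @ map (app 0 1) Xs)"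
    unfolding cost\<phi> by (simp add: power_mult_distrib gdet_nonneg)
  ultimately have "(\<Sum>\<alpha>\<leftarrow>map vec Ys. cost 2 \<alpha>)\<^sup>2
      + (\<Sum>\<beta>\<leftarrow>[\<beta> p q, \<beta> (- cnj q) (cnj p)]. cost D \<beta>)\<^sup>2 \<le> (cost (2 * D) \<phi>)\<^sup>2"
    using le by (simp only: power_mult_distrib) simp
  thus ?thesis using AB AC by blast
qed

lemma sum_list_concat_map: "(\<Sum>x\<leftarrow>concat xss. f x) = (\<Sum>xs\<leftarrow>xss. \<Sum>x\<leftarrow>xs. f x :: 'a::comm_monoid_add)"
  by (induction xss) simp_all

text \<open>This is the triangle inequality for the complex numbers with real parts a i and
  imaginary parts b i.\<close>

lemma minkowski_sum:
  fixes a b c :: "nat \<Rightarrow> real"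
  assumes "\<And>i. i < m \<Longrightarrow> (a i)\<^sup>2 + (b i)\<^sup>2 \<le> (c i)\<^sup>2" "\<And>i. i < m \<Longrightarrow> c i \<ge> 0"
  shows "(\<Sum>i<m. a i)\<^sup>2 + (\<Sum>i<m. b i)\<^sup>2 \<le> (\<Sum>i<m. c i)\<^sup>2"
proof -
  have "cmod (\<Sum>i<m. Complex (a i) (b i)) \<le> (\<Sum>i<m. cmod (Complex (a i) (b i)))" by (rule norm_sum)
  also have "\<dots> \<le> (\<Sum>i<m. c i)"
    by (rule sum_mono) (use assms in \<open>auto simp: cmod_def intro!: real_le_lsqrt\<close>)
  finally have "(cmod (\<Sum>i<m. Complex (a i) (b i)))\<^sup>2 \<le> (\<Sum>i<m. c i)\<^sup>2" by (rule power_mono) simp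
  thus ?thesis by (simp add: cmod_sq)
qed

lemma trace_ptrace2: "(\<Sum>a<n. ptrace2 n D \<rho> a a) = (\<Sum>i<n * D. \<rho> i i)"
proof -
  have "(\<Sum>y<D. \<rho> (a * D + y) (a * D + y)) = (\<Sum>i\<in>{a * D..<a * D + D}. \<rho> i i)" for a
    using sum.shift_bounds_nat_ivl[of "\<lambda>i. \<rho> i i" 0 "a * D" D]
    by (simp add: lessThan_atLeast0 add.commute)
  thus ?thesis unfolding ptrace2_def by (simp add: sum.nat_group)
qed

lemma trace_ptrace_mid:
  assumes "D > 0" shows "(\<Sum>a<2 * D. ptrace_mid 2 2 D \<rho> a a) = (\<Sum>i<2 * (2 * D). \<rho> i i)"
proof -
  have "(\<Sum>a<2 * D. ptrace_mid 2 2 D \<rho> a a) = (\<Sum>c<D. ptrace_mid 2 2 D \<rho> c c + ptrace_mid 2 2 D \<rho> (D + c) (D + c))"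
    by (rule sum_double)
  also have "\<dots> = (\<Sum>c<D. (\<rho> c c + \<rho> (D + c) (D + c)) + (\<rho> (2 * D + c) (2 * D + c) + \<rho> (2 * D + (D + c)) (2 * D + (D + c))))"
  proof (rule sum.cong)
    fix c assume "c \<in> {..<D}"
    hence "c div D = 0" "c mod D = c" "(D + c) div D = 1" "(D + c) mod D = c" using assms by auto
    thus "ptrace_mid 2 2 D \<rho> c c + ptrace_mid 2 2 D \<rho> (D + c) (D + c) = (\<rho> c c + \<rho> (D + c) (D + c))
        + (\<rho> (2 * D + c) (2 * D + c) + \<rho> (2 * D + (D + c)) (2 * D + (D + c)))"
      unfolding ptrace_mid_def by (simp add: numeral_2_eq_2 add_ac)
  qed simp
  also have "\<dots> = (\<Sum>i<2 * (2 * D). \<rho> i i)"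
    unfolding sum_double sum.distrib by (simp add: add_ac)
  finally show ?thesis .
qed

text \<open>Concatenating the ensembles found for the individual weighted vectors gives ensembles of
  both reduced states, and \<open>minkowski_sum\<close> combines the bounds. Nonnegativity of the
  concurrences allows their upper bounds to be squared.\<close>

lemma monogamy_ensemble:
  fixes m :: nat
  assumes D: "D > 0" and tr: "(\<Sum>i<4 * D. \<rho> i i) = 1"
    and p: "\<forall>i<m. p i \<ge> 0 \<and> unit_vec (2 * (2 * D)) (\<psi> i)"
    and \<rho>: "\<forall>a<2 * (2 * D). \<forall>b<2 * (2 * D). \<rho> a b = (\<Sum>i<m. complex_of_real (p i) * proj (\<psi> i) a b)"
    and nn: "0 \<le> conc 2 2 (ptrace2 4 D \<rho>)" "0 \<le> conc 2 D (ptrace_mid 2 2 D \<rho>)"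
  shows "(conc 2 2 (ptrace2 4 D \<rho>))\<^sup>2 + (conc 2 D (ptrace_mid 2 2 D \<rho>))\<^sup>2
    \<le> (\<Sum>i<m. p i * conc_pure 2 (2 * D) (\<psi> i))\<^sup>2"
proof -
  define \<phi> where "\<phi> i = (\<lambda>j. of_real (sqrt (p i)) * \<psi> i j)" for i
  have pr: "complex_of_real (p i) * proj (\<psi> i) a b = proj (\<phi> i) a b" if "i < m" for i a b
  proof -
    have "proj (\<phi> i) a b = of_real (sqrt (p i) * sqrt (p i)) * proj (\<psi> i) a b"
      unfolding \<phi>_def proj_def complex_cnj_mult complex_cnj_complex_of_real of_real_mult by (simp only: mult_ac)
    thus ?thesis using p that by simp
  qed
  have cst: "p i * conc_pure 2 (2 * D) (\<psi> i) = cost (2 * D) (\<phi> i)" if "i < m" for i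
    using p that by (simp add: conc_pure_cost \<phi>_def cost_scale)
  have "\<forall>i. \<exists>\<alpha>s \<beta>s. (\<forall>a<4. \<forall>b<4. ptrace2 4 D (proj (\<phi> i)) a b = (\<Sum>\<alpha>\<leftarrow>\<alpha>s. \<alpha> a * cnj (\<alpha> b))) \<and>
    (\<forall>a<2*D. \<forall>b<2*D. ptrace_mid 2 2 D (proj (\<phi> i)) a b = (\<Sum>\<beta>\<leftarrow>\<beta>s. \<beta> a * cnj (\<beta> b))) \<and>
    (\<Sum>\<alpha>\<leftarrow>\<alpha>s. cost 2 \<alpha>)\<^sup>2 + (\<Sum>\<beta>\<leftarrow>\<beta>s. cost D \<beta>)\<^sup>2 \<le> (cost (2 * D) (\<phi> i))\<^sup>2"
    using pure_monogamy[OF D] by blast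
  then obtain \<alpha>s \<beta>s where
    A: "\<And>i a b. a < 4 \<Longrightarrow> b < 4 \<Longrightarrow> ptrace2 4 D (proj (\<phi> i)) a b = (\<Sum>\<alpha>\<leftarrow>\<alpha>s i. \<alpha> a * cnj (\<alpha> b))" and
    B: "\<And>i a b. a < 2 * D \<Longrightarrow> b < 2 * D \<Longrightarrow> ptrace_mid 2 2 D (proj (\<phi> i)) a b = (\<Sum>\<beta>\<leftarrow>\<beta>s i. \<beta> a * cnj (\<beta> b))" and
    C: "\<And>i. (\<Sum>\<alpha>\<leftarrow>\<alpha>s i. cost 2 \<alpha>)\<^sup>2 + (\<Sum>\<beta>\<leftarrow>\<beta>s i. cost D \<beta>)\<^sup>2 \<le> (cost (2 * D) (\<phi> i))\<^sup>2"
    unfolding choice_iff by blast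
  have r: "\<rho> a b = (\<Sum>i<m. proj (\<phi> i) a b)" if "a < 2 * (2 * D)" "b < 2 * (2 * D)" for a b
    using \<rho> that by (simp add: pr)
  have cc: "(\<Sum>x\<leftarrow>concat (map xs [0..<m]). f x) = (\<Sum>i<m. \<Sum>x\<leftarrow>xs i. f x)"
    for xs :: "nat \<Rightarrow> (nat \<Rightarrow> complex) list" and f :: "_ \<Rightarrow> 'b::comm_monoid_add"
    by (simp add: sum_list_concat_map comp_def sum_list_upt)
  have ab: "conc 2 2 (ptrace2 4 D \<rho>) \<le> (\<Sum>i<m. \<Sum>\<alpha>\<leftarrow>\<alpha>s i. cost 2 \<alpha>)"
    unfolding cc[symmetric]
  proof (rule conc_le)
    fix a b :: nat assume ab: "a < 2 * 2" "b < 2 * 2"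
    have i: "k * D + y < 2 * (2 * D)" if "k < 2 * 2" "y < D" for k y
    proof -
      have "k * D \<le> 3 * D" using that by (intro mult_right_mono) auto
      thus ?thesis using that by linarith
    qed
    have "ptrace2 4 D \<rho> a b = (\<Sum>y<D. \<Sum>i<m. proj (\<phi> i) (a * D + y) (b * D + y))"
      unfolding ptrace2_def by (intro sum.cong refl r i) (use ab in auto)
    also have "\<dots> = (\<Sum>i<m. ptrace2 4 D (proj (\<phi> i)) a b)" unfolding ptrace2_def by (rule sum.swap)
    finally show "ptrace2 4 D \<rho> a b = (\<Sum>\<phi>\<leftarrow>concat (map \<alpha>s [0..<m]). \<phi> a * cnj (\<phi> b))"
      unfolding cc using ab by (simp add: A)
  next
    show "(\<Sum>a<2 * 2. ptrace2 4 D \<rho> a a) = 1" using trace_ptrace2[of 4 D \<rho>] tr by simp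
  qed
  have ac: "conc 2 D (ptrace_mid 2 2 D \<rho>) \<le> (\<Sum>i<m. \<Sum>\<beta>\<leftarrow>\<beta>s i. cost D \<beta>)"
    unfolding cc[symmetric]
  proof (rule conc_le)
    fix a b assume ab: "a < 2 * D" "b < 2 * D"
    have i: "(k div D * 2 + y) * D + k mod D < 2 * (2 * D)" if "k < 2 * D" "y < 2" for k y
    proof -
      have "k div D < 2" using that D by (simp add: div_less_iff_less_mult)
      hence "k div D * 2 + y \<le> 3" using that by linarith
      hence "(k div D * 2 + y) * D \<le> 3 * D" by (rule mult_right_mono) simp
      moreover have "k mod D < D" using D by simp
      ultimately show ?thesis by linarith
    qed
    have "ptrace_mid 2 2 D \<rho> a b = (\<Sum>y<2. \<Sum>i<m. proj (\<phi> i) ((a div D * 2 + y) * D + a mod D) ((b div D * 2 + y) * D + b mod D))"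
      unfolding ptrace_mid_def by (intro sum.cong refl r i) (use ab in auto)
    also have "\<dots> = (\<Sum>i<m. ptrace_mid 2 2 D (proj (\<phi> i)) a b)" unfolding ptrace_mid_def by (rule sum.swap)
    finally show "ptrace_mid 2 2 D \<rho> a b = (\<Sum>\<phi>\<leftarrow>concat (map \<beta>s [0..<m]). \<phi> a * cnj (\<phi> b))"
      unfolding cc using ab by (simp add: B)
  next
    show "(\<Sum>a<2 * D. ptrace_mid 2 2 D \<rho> a a) = 1" using trace_ptrace_mid[OF D, of \<rho>] tr by simp
  qed
  have "(conc 2 2 (ptrace2 4 D \<rho>))\<^sup>2 + (conc 2 D (ptrace_mid 2 2 D \<rho>))\<^sup>2
     \<le> (\<Sum>i<m. \<Sum>\<alpha>\<leftarrow>\<alpha>s i. cost 2 \<alpha>)\<^sup>2 + (\<Sum>i<m. \<Sum>\<beta>\<leftarrow>\<beta>s i. cost D \<beta>)\<^sup>2"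
    using ab ac nn by (intro add_mono power_mono)
  also have "\<dots> \<le> (\<Sum>i<m. cost (2 * D) (\<phi> i))\<^sup>2" by (rule minkowski_sum) (auto simp: C cost_nonneg)
  also have "(\<Sum>i<m. cost (2 * D) (\<phi> i)) = (\<Sum>i<m. p i * conc_pure 2 (2 * D) (\<psi> i))"
    by (intro sum.cong refl) (simp add: cst)
  finally show ?thesis .
qed

text \<open>The bound holds for every decomposition of \<rho>, hence for their infimum.\<close>

lemma concurrence_monogamy:
  assumes D: "D > 0" and state: "density_op (2 * 2 * D) \<rho>"
    and nn: "0 \<le> conc 2 2 (ptrace2 4 D \<rho>)" "0 \<le> conc 2 D (ptrace_mid 2 2 D \<rho>)"
  shows "sqrt ((conc 2 2 (ptrace2 4 D \<rho>))\<^sup>2 + (conc 2 D (ptrace_mid 2 2 D \<rho>))\<^sup>2) \<le> conc 2 (2 * D) \<rho>"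
proof -
  have tr: "(\<Sum>i<4 * D. \<rho> i i) = 1" using state by (simp add: density_op_def)
  have "Im (herm_form (2 * (2 * D)) \<rho> v) = 0 \<and> Re (herm_form (2 * (2 * D)) \<rho> v) \<ge> 0" for v
    using state by (simp add: density_op_def herm_form_def)
  from psd_ensemble[OF this] obtain \<phi>s where
    \<phi>s: "\<forall>a<2 * (2 * D). \<forall>b<2 * (2 * D). \<rho> a b = (\<Sum>\<phi>\<leftarrow>\<phi>s. \<phi> a * cnj (\<phi> b))" by blast
  obtain m :: nat and p \<psi> where "(\<forall>i<m. p i \<ge> 0 \<and> unit_vec (2 * (2 * D)) (\<psi> i)) \<and> (\<Sum>i<m. p i) = (1::real) \<and>
    (\<forall>a<2 * (2 * D). \<forall>b<2 * (2 * D). \<rho> a b = (\<Sum>i<m. complex_of_real (p i) * proj (\<psi> i) a b))"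
    by (rule normalise_ensemble[of "2 * D" \<rho> \<phi>s]) (use \<phi>s tr in auto)
  \<comment> \<open>Passing a lower bound to the infimum requires at least one decomposition;
    positivity of \<rho> provides it.\<close>
  hence ne: "{(\<Sum>i<m. p i * conc_pure 2 (2 * D) (\<psi> i)) |(m::nat) p \<psi>.
       (\<forall>i<m. p i \<ge> 0 \<and> unit_vec (2 * (2 * D)) (\<psi> i)) \<and> (\<Sum>i<m. p i) = 1 \<and>
       (\<forall>a<2 * (2 * D). \<forall>b<2 * (2 * D). \<rho> a b = (\<Sum>i<m. complex_of_real (p i) * proj (\<psi> i) a b))} \<noteq> {}" by blast
  show ?thesis unfolding conc_def[of 2 "2 * D"]
  proof (rule cInf_greatest[OF ne])
    fix x assume "x \<in> {(\<Sum>i<m. p i * conc_pure 2 (2 * D) (\<psi> i)) |(m::nat) p \<psi>.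
       (\<forall>i<m. p i \<ge> 0 \<and> unit_vec (2 * (2 * D)) (\<psi> i)) \<and> (\<Sum>i<m. p i) = 1 \<and>
       (\<forall>a<2 * (2 * D). \<forall>b<2 * (2 * D). \<rho> a b = (\<Sum>i<m. complex_of_real (p i) * proj (\<psi> i) a b))}"
    then obtain m :: nat and p \<psi> where x: "x = (\<Sum>i<m. p i * conc_pure 2 (2 * D) (\<psi> i))"
      and p: "\<forall>i<m. p i \<ge> 0 \<and> unit_vec (2 * (2 * D)) (\<psi> i)"
      and r: "\<forall>a<2 * (2 * D). \<forall>b<2 * (2 * D). \<rho> a b = (\<Sum>i<m. complex_of_real (p i) * proj (\<psi> i) a b)"
      by blast
    have "0 \<le> x" unfolding x by (rule ensemble_average_nonneg[OF p])
    thus "sqrt ((conc 2 2 (ptrace2 4 D \<rho>))\<^sup>2 + (conc 2 D (ptrace_mid 2 2 D \<rho>))\<^sup>2) \<le> x"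
      using monogamy_ensemble[OF D tr p r nn] unfolding x by (rule real_le_lsqrt)
  qed
qed

section \<open>Inequalities between powers\<close>

text \<open>With c the square root on the right, x^s is at most c^(s - 2) x^2 for 0 < x \<le> c, and
  the two squares add up to c^2.\<close>

lemma powr_sum_le:
  fixes a b s :: real
  assumes "a > 0" "b > 0" "s \<ge> 2"
  shows "a powr s + b powr s \<le> (sqrt (a\<^sup>2 + b\<^sup>2)) powr s"
proof -
  define c where "c = sqrt (a\<^sup>2 + b\<^sup>2)"
  have c: "c > 0" "c\<^sup>2 = a\<^sup>2 + b\<^sup>2" using assms by (auto simp: c_def intro!: add_pos_nonneg)
  have le: "x powr s \<le> c powr (s - 2) * x\<^sup>2" if "0 < x" "x \<le> c" for x
  proof -
    have "x powr s = x powr (s - 2) * x powr 2" by (simp flip: powr_add)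
    also have "\<dots> \<le> c powr (s - 2) * x powr 2" using that assms by (intro mult_right_mono powr_mono2) auto
    finally show ?thesis using that by (simp add: powr_numeral)
  qed
  have "a \<le> c" "b \<le> c" by (simp_all add: c_def real_le_rsqrt)
  hence "a powr s + b powr s \<le> c powr (s - 2) * c\<^sup>2"
    using le[of a] le[of b] assms by (simp add: c(2) distrib_left)
  also have "\<dots> = c powr s" using c(1) by (simp flip: powr_numeral powr_add)
  finally show ?thesis by (simp add: c_def)
qed

text \<open>In the s-th powers x, y and with g = \<beta> / s \<le> 0, the sum x + y is at least (1 +
  k) x. It then suffices to bound (1 + k)^g by a convex combination of itself and the larger
  q^g.\<close>

lemma negative_power_bound:
  fixes a b c k q \<beta> s :: real
  assumes ab: "a > 0" "b > 0" and c: "sqrt (a\<^sup>2 + b\<^sup>2) \<le> c"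
    and k: "k \<ge> 1" and q: "0 < q" "q \<le> 1" and beta: "\<beta> \<le> 0" and s: "s \<ge> 2"
    and le: "k * a powr s \<le> b powr s"
  shows "c powr \<beta> \<le> q powr (\<beta> / s) * a powr \<beta> + ((1 + k) powr (\<beta> / s) - q powr (\<beta> / s)) / k powr (\<beta> / s) * b powr \<beta>"
proof -
  define g where "g = \<beta> / s"
  have g: "g \<le> 0" using beta s by (simp add: g_def divide_nonpos_pos)
  have pw: "x powr \<beta> = (x powr s) powr g" for x using s by (simp add: g_def powr_powr)
  define x y where "x = a powr s" and "y = b powr s"
  have x: "x > 0" and y: "y > 0" using ab by (simp_all add: x_def y_def)
  have "x + y \<le> c powr s"
    using powr_sum_le[OF ab s] powr_mono2[of s "sqrt (a\<^sup>2 + b\<^sup>2)" c] c s by (simp add: x_def y_def)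
  hence 1: "c powr \<beta> \<le> (x + y) powr g" unfolding pw using x y g by (intro powr_mono2') auto
  \<comment> \<open>This weight turns w x^g into y^g / k^g; it lies in [0, 1] because y \<ge> k x
    and g \<le> 0.\<close>
  define w where "w = (y / (k * x)) powr g"
  have ge: "y / (k * x) \<ge> 1" using le x k by (simp add: x_def y_def le_divide_eq)
  have w: "0 \<le> w" "w \<le> 1"
    using powr_mono2'[of g 1 "y / (k * x)"] ge g by (simp_all add: w_def)
  have "(x + y) powr g \<le> ((1 + k) * x) powr g"
    using le x y g k by (intro powr_mono2') (auto simp: x_def y_def algebra_simps add_pos_pos)
  also have "\<dots> = (1 + k) powr g * x powr g" using x k by (simp add: powr_mult)
  also have "(1 + k) powr g \<le> q powr g * (1 - w) + (1 + k) powr g * w"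
  proof -
    have "(1 + k) powr g \<le> q powr g" using q k g by (intro powr_mono2') auto
    hence "(1 + k) powr g * (1 - w) \<le> q powr g * (1 - w)" using w by (intro mult_right_mono) auto
    thus ?thesis by (simp add: algebra_simps)
  qed
  hence "(1 + k) powr g * x powr g \<le> (q powr g * (1 - w) + (1 + k) powr g * w) * x powr g"
    by (rule mult_right_mono) simp
  also have "\<dots> = q powr g * x powr g + ((1 + k) powr g - q powr g) * (w * x powr g)"
    by (simp add: algebra_simps)
  also have "w * x powr g = y powr g / k powr g"
    using x y k by (simp add: w_def powr_divide powr_mult)
  finally show ?thesis using 1 unfolding pw x_def[symmetric] y_def[symmetric] g_def[symmetric] by simp
qed

text \<open>Monogamy feeds the power inequality. Positivity of the reduced concurrences keeps the
  powers meaningful: a negative power of zero is undefined, while \<open>powr\<close> returns 0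
  there.\<close>

theorem theorem3:
  fixes n :: nat and \<rho> :: "nat \<Rightarrow> nat \<Rightarrow> complex"
    and k q \<beta> s :: real
  defines "D \<equiv> 2 ^ (n - 2)"
  assumes n: "n \<ge> 3"
    and state: "density_op (2 * 2 * D) \<rho>"
    and k: "k \<ge> 1" and q: "0 < q" "q \<le> 1" and beta: "\<beta> \<le> 0" and s: "s \<ge> 2"
    and pos12: "conc 2 2 (ptrace2 4 D \<rho>) > 0"
    and pos13: "conc 2 D (ptrace_mid 2 2 D \<rho>) > 0"
  shows
    "(conc 2 D (ptrace_mid 2 2 D \<rho>) powr s \<ge> k * conc 2 2 (ptrace2 4 D \<rho>) powr s \<longrightarrow>
       conc 2 (2 * D) \<rho> powr \<beta>
         \<le> q powr (\<beta> / s) * conc 2 2 (ptrace2 4 D \<rho>) powr \<beta>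
           + ((1 + k) powr (\<beta> / s) - q powr (\<beta> / s)) / k powr (\<beta> / s)
             * conc 2 D (ptrace_mid 2 2 D \<rho>) powr \<beta>)
   \<and> (conc 2 2 (ptrace2 4 D \<rho>) powr s \<ge> k * conc 2 D (ptrace_mid 2 2 D \<rho>) powr s \<longrightarrow>
       conc 2 (2 * D) \<rho> powr \<beta>
         \<le> q powr (\<beta> / s) * conc 2 D (ptrace_mid 2 2 D \<rho>) powr \<beta>
           + ((1 + k) powr (\<beta> / s) - q powr (\<beta> / s)) / k powr (\<beta> / s)
             * conc 2 2 (ptrace2 4 D \<rho>) powr \<beta>)"
proof -
  have "sqrt ((conc 2 2 (ptrace2 4 D \<rho>))\<^sup>2 + (conc 2 D (ptrace_mid 2 2 D \<rho>))\<^sup>2) \<le> conc 2 (2 * D) \<rho>"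
    by (rule concurrence_monogamy) (use state pos12 pos13 in \<open>auto simp: D_def\<close>)
  \<comment> \<open>Monogamy is symmetric in the two reduced concurrences, so the second claim
    follows by exchanging them.\<close>
  thus ?thesis
    using negative_power_bound[OF pos12 pos13 _ k q beta s] negative_power_bound[OF pos13 pos12 _ k q beta s]
    by (simp add: add.commute[of "(conc 2 D (ptrace_mid 2 2 D \<rho>))\<^sup>2"])
qed

end
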